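(* (i) For every real $q$ with $0<q<1$, $$\frac{(q;q)_\infty^4}{(q^{1/2};q)_\infty^3\,(q^{3/2};q)_\infty} =\sum_{n=0}^{\infty}q^{2n^2+\frac{3n}2}\frac{(q,q^{1/2},q^{1/2};q)_n\,(q,q^{3/2},q^{3/2};q)_{2n}\,(1-q^{2n+1})(1-q^{4n+2})}{(q^{3/2};q)_n\,(q^{3/2};q)_{2n}\,(q,q^{3/2};q)_{3n}\,(1-q^{3n+1})(1-q^{3n+\frac32})^2}$$ $$\times\Bigg\{q^{n+\frac12}+\frac{(1-q^{n+\frac12})(1-q^{3n+1})(1-q^{3n+\frac32})^2(1-q^{5n+1})}{(1-q^{2n+1})(1-q^{2n+\frac12})^2(1-q^{3n+\frac12})(1-q^{4n+2})}$$ $$+q^{3n+2}\frac{(1-q^{n+\frac12})^2(1-q^{n+1})(1-q^{3n+\frac32})(1-q^{5n+4})}{(1-q^{3n+2})(1-q^{2n+\frac32})(1-q^{3n+\frac52})^2(1-q^{4n+2})}\Bigg\}.$$ (ii) The corresponding classical identity (the case $q\to1$) holds: $$\frac{9\pi^2}{16}=\sum_{n=0}^{\infty}\frac{(2n)!\,(4n+1)!}{(6n+1)!\,(1+2n)(1+3n)}\Bigg\{1+\frac{9(1+2n)(1+3n)(1+5n)}{2(1+4n)^2(1+6n)}+\frac{3(1+n)(1+2n)^2(4+5n)}{2(2+3n)(3+4n)(5+6n)^2}\Bigg\}.$$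
   Context: $(x;q)_0=1$, $(x;q)_n=\prod_{j=0}^{n-1}(1-q^jx)$, $(x;q)_\infty=\prod_{j\ge0}(1-q^jx)$, and $(x_1,\dots,x_r;q)_n=(x_1;q)_n\cdots(x_r;q)_n$. Fractional powers of $q$ are the positive real ones. *)

theory Defs
  imports "HOL-Analysis.Analysis"
begin

definition qpoch :: "real \<Rightarrow> real \<Rightarrow> nat \<Rightarrow> real" where
  "qpoch x q n = (\<Prod>j<n. 1 - q ^ j * x)"

definition qpoch_inf :: "real \<Rightarrow> real \<Rightarrow> real" where
  "qpoch_inf x q = (\<Prod>j. 1 - q ^ j * x)"

definition qpochs :: "real list \<Rightarrow> real \<Rightarrow> nat \<Rightarrow> real" where
  "qpochs xs q n = (\<Prod>x\<leftarrow>xs. qpoch x q n)"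

text \<open>
  The infinite product converges whenever \<open>0 < q < 1\<close>, so the library's \<open>prodinf\<close>
  denotes its value there.
\<close>
lemma qpoch_inf_has_prod:
  assumes "0 < q" "q < 1"
  shows "(\<lambda>j. 1 - q ^ j * x) has_prod qpoch_inf x q"
proof -
  have "summable (\<lambda>j. norm (q ^ j * x))"
    using assms by (simp add: abs_mult power_abs summable_mult2 summable_geometric)
  then have "summable (\<lambda>j. norm ((1 - q ^ j * x) - 1))"
    by simp
  then have "abs_convergent_prod (\<lambda>j. 1 - q ^ j * x)"
    by (rule summable_imp_abs_convergent_prod)
  then have "convergent_prod (\<lambda>j. 1 - q ^ j * x)"
    by (rule abs_convergent_prod_imp_convergent_prod)
  then show ?thesis
    unfolding qpoch_inf_def by (rule convergent_prod_has_prod)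
qed

end

(*
  The very-well-poised series
    Omega(a;b,c,d,e) = sum_k (1 - a q^(2k)) (b,c,d,e;q)_k / (aq/b,aq/c,aq/d,aq/e;q)_k w^k,  w = q a^2/(bcde),
  satisfies, by summation by parts, the recursion
    Omega(a;b,c,d,e) = (1 - a/e)(1 - we)/(1 - w) + R Omega(aq;b,c,d,eq)
  with an explicit ratio R. Two iterations starting from Omega(q; q^(1/2), q^(1/2), q^(1/2), q) give the
  two sides of (i). Shifting the parameter e = a, the boundary term vanishes and the product of the ratios
  evaluates Omega (this is the nonterminating 6phi5 sum). Keeping one parameter q^(1/2) and the parameter q
  fixed and shifting the other two in the order d, c, d, three steps contribute the three terms in the
  braces (in the order second, first, third), and lead from index n to n + 1. Part (ii) is the same
  argument for the limiting ordinary series, whose initial value is sum_k 1/(2k+1)^2 = pi^2/8.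
*)
theory Submission
  imports Defs
begin

section \<open>The very-well-poised series and its recursion\<close>

lemma qpoch_0 [simp]: "qpoch x q 0 = 1" by (simp add: qpoch_def)

lemma qpoch_Suc: "qpoch x q (Suc n) = qpoch x q n * (1 - q ^ n * x)"
  by (simp add: qpoch_def)

text \<open>Both sides are the product of the factors of \<open>qpoch x q (Suc n)\<close>, split
  after the first factor or before the last one.\<close>

lemma qpoch_shift: "(1 - x) * qpoch (x * q) q n = qpoch x q n * (1 - q ^ n * x)"
  by (induction n) (simp_all add: qpoch_Suc mult_ac)

lemma pow_q_less_1:
  fixes q x :: real
  assumes "0 < q" "q < 1" "x < 1"
  shows "q ^ j * x < 1"
proof (cases "x \<le> 0")
  case True
  then have "q ^ j * x \<le> 0" using assms by (simp add: mult_le_0_iff)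
  then show ?thesis by simp
next
  case False
  then have "q ^ j * x \<le> 1 * x" using assms by (intro mult_right_mono power_le_one) auto
  then show ?thesis using assms by simp
qed

text \<open>Summed with the extra factor in \<open>vwp\<close>, this is (1 - a) times the
  very-well-poised 8phi7 series in which one further upper parameter is q, so that the usual
  quotient (a;q)_k/(q;q)_k cancels. The weight stands apart because the boundary terms of the
  summation by parts are multiples of it.\<close>

definition wp :: "real \<Rightarrow> real \<Rightarrow> real \<Rightarrow> real \<Rightarrow> real \<Rightarrow> real \<Rightarrow> nat \<Rightarrow> real" where
  "wp q a b c d e k =
     qpoch b q k * qpoch c q k * qpoch d q k * qpoch e q k
     / (qpoch (a * q / b) q k * qpoch (a * q / c) q k * qpoch (a * q / d) q k * qpoch (a * q / e) q k)
     * (q * a\<^sup>2 / (b * c * d * e)) ^ k"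

definition vwp :: "real \<Rightarrow> real \<Rightarrow> real \<Rightarrow> real \<Rightarrow> real \<Rightarrow> real \<Rightarrow> nat \<Rightarrow> real" where
  "vwp q a b c d e k = (1 - a * q ^ (2 * k)) * wp q a b c d e k"

definition vwp_ratio :: "real \<Rightarrow> real \<Rightarrow> real \<Rightarrow> real \<Rightarrow> real \<Rightarrow> real \<Rightarrow> real" where
  "vwp_ratio q a b c d e =
     a / e * (1 - e) * (1 - a * q / (b * c)) * (1 - a * q / (b * d)) * (1 - a * q / (c * d))
     / ((1 - q * a\<^sup>2 / (b * c * d * e)) * (1 - a * q / b) * (1 - a * q / c) * (1 - a * q / d))"

lemma wp_Suc:
  "wp q a b c d e (Suc k) = wp q a b c d e k * (q * a\<^sup>2 / (b * c * d * e))
     * ((1 - q ^ k * b) * (1 - q ^ k * c) * (1 - q ^ k * d) * (1 - q ^ k * e))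
     / ((1 - q ^ k * (a * q / b)) * (1 - q ^ k * (a * q / c)) * (1 - q ^ k * (a * q / d))
        * (1 - q ^ k * (a * q / e)))"
  by (simp add: wp_def qpoch_Suc mult_ac)

text \<open>Replacing a, e by aq, eq keeps aq/e and multiplies e and the other three lower
  parameters by q. Each of these four symbols changes by one quotient of factors, as in
  \<open>qpoch_shift\<close>, and the argument gains a factor q, whence
  \<open>q ^ k\<close>.\<close>

lemma wp_shift:
  assumes q: "0 < q" "q < 1" and nz: "b \<noteq> 0" "c \<noteq> 0" "d \<noteq> 0" "e \<noteq> 0"
    and "e < 1" "a * q / b < 1" "a * q / c < 1" "a * q / d < 1"
  shows "wp q (a * q) b c d (e * q) k = wp q a b c d e k * q ^ k * (1 - q ^ k * e) / (1 - e)
    * ((1 - a * q / b) * (1 - a * q / c) * (1 - a * q / d))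
    / ((1 - q ^ k * (a * q / b)) * (1 - q ^ k * (a * q / c)) * (1 - q ^ k * (a * q / d)))"
proof -
  have up: "qpoch (x * q) q k = qpoch x q k * (1 - q ^ k * x) / (1 - x)" if "x < 1" for x
    using qpoch_shift[of x q k] that by (simp add: field_simps)
  have eq: "a * q * q / (e * q) = a * q / e" "a * q * q / b = a * q / b * q"
    "a * q * q / c = a * q / c * q" "a * q * q / d = a * q / d * q"
    using q by auto
  have w: "q * (a * q)\<^sup>2 / (b * c * d * (e * q)) = q * a\<^sup>2 / (b * c * d * e) * q"
    using q nz by (simp add: field_simps power2_eq_square)
  define W where "W = q * a\<^sup>2 / (b * c * d * e)"
  show ?thesis
    unfolding wp_def eq w W_def[symmetric] up[OF assms(7)] up[OF assms(8)] up[OF assms(9)] up[OF assms(10)]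
    by (simp add: power_mult_distrib mult_ac)
qed

text \<open>The summation by parts works because, with \<open>f = w e q\<close> and
  \<open>f' = a q / f\<close>, the quartics \<open>\<Prod>(1 - b x)\<close> over \<open>b, c, d, f\<close> and \<open>\<Prod>(1 - (a q / b) x)\<close> differ by a
  multiple of \<open>x (1 - a q x\<^sup>2)\<close>.\<close>

lemma vwp_telescope:
  assumes q: "0 < q" "q < 1" and nz: "a \<noteq> 0" "b \<noteq> 0" "c \<noteq> 0" "d \<noteq> 0" "e \<noteq> 0"
    and e: "e < 1" and lt: "a * q / b < 1" "a * q / c < 1" "a * q / d < 1" "a * q / e < 1"
    and w: "w = q * a\<^sup>2 / (b * c * d * e)" "w \<noteq> 1"
    and V: "\<And>k. V k = wp q a b c d e k * (1 - q ^ k * a / e) * (1 - w * e * q ^ k) / (1 - w)"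
  shows "vwp q a b c d e k = vwp_ratio q a b c d e * vwp q (a * q) b c d (e * q) k + (V k - V (Suc k))"
proof -
  define x where "x = q ^ k"
  have x: "q ^ (2 * k) = x\<^sup>2" "q ^ Suc k = q * x" by (simp_all add: x_def power_mult_distrib mult.commute[of 2] power_mult)
  define h where "h = wp q a b c d e k"
  have n: "1 - x * (a * q / b) \<noteq> 0" "1 - x * (a * q / c) \<noteq> 0" "1 - x * (a * q / d) \<noteq> 0" "1 - x * (a * q / e) \<noteq> 0"
    using pow_q_less_1[OF q, of _ k] lt unfolding x_def by (smt (verit))+
  define P where "P = (1 - x * (a * q / b)) * (1 - x * (a * q / c)) * (1 - x * (a * q / d))"
  define Q where "Q = (1 - x * b) * (1 - x * c) * (1 - x * d)"
  define L where "L = (1 - a * q / (b * c)) * (1 - a * q / (b * d)) * (1 - a * q / (c * d))"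
  have P0: "P \<noteq> 0" using n by (simp add: P_def)
  \<comment> \<open>Since b c d f = (a q)^2, the quartics share their coefficients of 1, x^2 and
    x^4, and the differences of those of x and x^3 are in the ratio 1 : -a q. The difference of the
    linear coefficients factors, which produces \<open>L\<close>.\<close>
  have key: "w * Q * (1 - w * e * (q * x)) = w * P * (1 - a * x / (w * e)) + a / e * x * (1 - a * q * x\<^sup>2) * L"
    unfolding w P_def Q_def L_def using nz q by (simp add: field_simps) algebra
  \<comment> \<open>The linear coefficients of the two products agree, so only \<open>1 - w\<close>
    times the very-well-poised factor remains.\<close>
  have quad: "(1 - x * a / e) * (1 - w * e * x) - (1 - x * e) * w * (1 - a * x / (w * e)) = (1 - w) * (1 - a * x\<^sup>2)"
    unfolding w using nz q by (simp add: field_simps) algebra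
  \<comment> \<open>The factor \<open>1 - q ^ Suc k * a / e\<close> of \<open>V (Suc k)\<close>
    cancels the fourth denominator in \<open>wp_Suc\<close>, leaving the cubics \<open>P\<close> and
    \<open>Q\<close>.\<close>
  have V1: "V (Suc k) * (1 - w) = h * (1 - x * e) / P * (w * Q * (1 - w * e * (q * x)))"
  proof -
    define y where "y = 1 - x * (a * q / e)"
    have y: "1 - q ^ Suc k * a / e = y" "1 - x * (a * q / e) = y" "y \<noteq> 0"
      using n(4) by (simp_all add: x_def y_def)
    show ?thesis unfolding V wp_Suc w(1)[symmetric] y(1)
      using y(3) w(2) unfolding x_def[symmetric] y(2) P_def Q_def h_def x by simp
  qed
  have solve: "u = p * z - r / (1 - w)" if "u * (1 - w) = p * ((1 - w) * z) - r" for u p z r :: real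
    using that w(2) by (simp add: field_simps)
  have "(V k - V (Suc k)) * (1 - w) = h * ((1 - x * a / e) * (1 - w * e * x)) - h * (1 - x * e) / P * (w * Q * (1 - w * e * (q * x)))"
    using V1 w(2) by (simp add: left_diff_distrib V h_def x_def)
  also have "\<dots> = h * ((1 - w) * (1 - a * x\<^sup>2)) - h * (1 - x * e) / P * (a / e * x * (1 - a * q * x\<^sup>2) * L)"
    unfolding key quad[symmetric] using P0 by (simp add: field_simps)
  finally have A: "V k - V (Suc k) = h * (1 - a * x\<^sup>2) - h * (1 - x * e) / P * (a / e * x * (1 - a * q * x\<^sup>2) * L) / (1 - w)"
    using solve by blast
  define M where "M = (1 - a * q / b) * (1 - a * q / c) * (1 - a * q / d)"
  have M: "M \<noteq> 0" using lt by (auto simp only: M_def mult_eq_0_iff right_minus_eq less_irrefl)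
  have r: "vwp_ratio q a b c d e = a / e * (1 - e) * L / ((1 - w) * M)"
    unfolding vwp_ratio_def w(1)[symmetric] L_def M_def by (simp only: mult.assoc)
  have "wp q (a * q) b c d (e * q) k = h * x * (1 - x * e) / (1 - e) * (M / P)"
    unfolding wp_shift[OF q nz(2-5) e lt(1-3)] M_def P_def h_def x_def by simp
  then have "vwp_ratio q a b c d e * vwp q (a * q) b c d (e * q) k = h * (1 - x * e) / P * (a / e * x * (1 - a * q * x\<^sup>2) * L) / (1 - w)"
    unfolding vwp_def x r using M e by (simp add: mult_ac)
  then show ?thesis unfolding A by (simp add: vwp_def x h_def)
qed

section \<open>Limits and uniform bounds for q-shifted factorials and for the weights\<close>

lemma qpoch_tendsto:
  assumes "0 < q" "q < 1"
  shows "(\<lambda>n. qpoch x q n) \<longlonglongrightarrow> qpoch_inf x q"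
proof -
  have "(\<lambda>n. \<Prod>j\<le>n. 1 - q ^ j * x) \<longlonglongrightarrow> qpoch_inf x q"
    using qpoch_inf_has_prod[OF assms] by (metis convergent_prod_LIMSEQ has_prod_iff)
  then have "(\<lambda>n. qpoch x q (Suc n)) \<longlonglongrightarrow> qpoch_inf x q"
    by (simp add: qpoch_def lessThan_Suc_atMost)
  then show ?thesis by (rule LIMSEQ_imp_Suc)
qed

lemma qpoch_inf_nonzero:
  assumes "0 < q" "q < 1" "x < 1"
  shows "qpoch_inf x q \<noteq> 0"
proof -
  have "1 - q ^ j * x \<noteq> 0" for j
    using pow_q_less_1[OF assms, of j] by simp
  then show ?thesis
    using has_prod_eq_0_iff[OF qpoch_inf_has_prod[OF assms(1,2)], of x] by auto
qed

lemma qpoch_inf_shift: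
  assumes "0 < q" "q < 1"
  shows "qpoch_inf x q = (1 - x) * qpoch_inf (x * q) q"
proof -
  have "(\<lambda>n. (1 - x) * qpoch (x * q) q n) \<longlonglongrightarrow> (1 - x) * qpoch_inf (x * q) q"
    by (intro tendsto_mult_left qpoch_tendsto assms)
  moreover have "(\<lambda>n. qpoch x q n * (1 - q ^ n * x)) \<longlonglongrightarrow> qpoch_inf x q * (1 - 0 * x)"
    using assms by (intro tendsto_intros qpoch_tendsto LIMSEQ_realpow_zero) auto
  ultimately show ?thesis
    unfolding qpoch_shift using LIMSEQ_unique by fastforce
qed

lemma qpoch_bounds:
  assumes q: "0 < q" "q < 1" and x: "0 \<le> x" "x \<le> 1"
  shows "0 \<le> qpoch x q n" "qpoch x q n \<le> 1"
proof -
  have "0 \<le> q ^ j * x \<and> q ^ j * x \<le> 1" for j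
    using q x by (simp add: mult_le_one power_le_one)
  then show "0 \<le> qpoch x q n" "qpoch x q n \<le> 1"
    unfolding qpoch_def by (auto intro!: prod_nonneg prod_le_1)
qed

text \<open>(y;q)_n decreases to its positive limit, and a smaller base gives larger factors. So one
  constant bounds the denominators below for all n and all bases up to y.\<close>

lemma qpoch_ge:
  assumes q: "0 < q" "q < 1" and x: "0 \<le> x" "x \<le> y" "y < 1"
  shows "0 < qpoch_inf y q" "qpoch_inf y q \<le> qpoch x q n"
proof -
  have f: "0 \<le> 1 - q ^ j * y \<and> 1 - q ^ j * y \<le> 1 - q ^ j * x \<and> 1 - q ^ j * y \<le> 1" for j
    using pow_q_less_1[OF q x(3), of j] q x by (simp add: mult_left_mono)
  have "decseq (qpoch y q)"
    using f qpoch_bounds(1)[OF q, of y] x by (intro decseq_SucI) (simp add: qpoch_Suc mult_left_le)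
  then have le: "qpoch_inf y q \<le> qpoch y q n" for n
    using qpoch_tendsto[OF q] by (rule decseq_ge)
  show "qpoch_inf y q \<le> qpoch x q n"
    using le[of n] prod_mono[of "{..<n}" "\<lambda>j. 1 - q ^ j * y" "\<lambda>j. 1 - q ^ j * x"] f
    unfolding qpoch_def by (smt (verit))
  have "0 \<le> qpoch_inf y q"
    by (rule LIMSEQ_le_const[OF qpoch_tendsto[OF q]]) (use qpoch_bounds(1)[OF q, of y] x in auto)
  then show "0 < qpoch_inf y q"
    using qpoch_inf_nonzero[OF q x(3)] by simp
qed

text \<open>The numerator symbols lie in [0,1] and each of the four denominators is at least
  (y;q)_inf. The constant depends only on y and q, which makes the bound uniform along a sequence of
  shifted parameters.\<close>

lemma wp_bounds:
  assumes q: "0 < q" "q < 1" and y: "y < 1"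
    and num: "0 \<le> b" "b \<le> 1" "0 \<le> c" "c \<le> 1" "0 \<le> d" "d \<le> 1" "0 \<le> e" "e \<le> 1"
    and den: "0 \<le> a * q / b" "a * q / b \<le> y" "0 \<le> a * q / c" "a * q / c \<le> y"
      "0 \<le> a * q / d" "a * q / d \<le> y" "0 \<le> a * q / e" "a * q / e \<le> y"
    and w: "w = q * a\<^sup>2 / (b * c * d * e)" 
  shows "0 \<le> wp q a b c d e k" "wp q a b c d e k \<le> w ^ k / qpoch_inf y q ^ 4"
proof -
  let ?P = "qpoch_inf y q"
  have P: "0 < ?P" using qpoch_ge(1)[OF q den(1,2) y] .
  have w0: "0 \<le> w" unfolding w using q num by simp
  define N where "N = qpoch b q k * qpoch c q k * qpoch d q k * qpoch e q k"
  define D where "D = qpoch (a * q / b) q k * qpoch (a * q / c) q k * qpoch (a * q / d) q k * qpoch (a * q / e) q k"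
  have N: "0 \<le> N" "N \<le> 1"
    unfolding N_def using qpoch_bounds[OF q] num by (simp_all add: mult_le_one)
  have ge: "?P \<le> qpoch x q k \<and> 0 \<le> qpoch x q k" if "0 \<le> x" "x \<le> y" for x
    using qpoch_ge(2)[OF q that y, of k] P by linarith
  have "?P * ?P * ?P * ?P \<le> D"
    unfolding D_def using ge[OF den(1,2)] ge[OF den(3,4)] ge[OF den(5,6)] ge[OF den(7,8)] P
    by (intro mult_mono mult_nonneg_nonneg) linarith+
  then have D: "?P ^ 4 \<le> D" by (simp add: power4_eq_xxxx)
  have D0: "0 < D" using D P by (smt (verit) zero_less_power)
  have eq: "wp q a b c d e k = N / D * w ^ k" by (simp add: wp_def N_def D_def w)
  show "0 \<le> wp q a b c d e k" unfolding eq using N D0 w0 by simp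
  have "N / D \<le> 1 / ?P ^ 4" using N D P by (intro frac_le) auto
  then show "wp q a b c d e k \<le> w ^ k / ?P ^ 4"
    unfolding eq using mult_right_mono[OF _ zero_le_power[OF w0]] by fastforce
qed

text \<open>The parameters are recorded as exponents of \<open>s\<close>, where \<open>q = s\<^sup>2\<close>.\<close>
definition omega_term :: "real \<Rightarrow> nat \<Rightarrow> nat \<Rightarrow> nat \<Rightarrow> nat \<Rightarrow> nat \<Rightarrow> nat \<Rightarrow> real" where
  "omega_term s A B C D E = vwp (s\<^sup>2) (s ^ A) (s ^ B) (s ^ C) (s ^ D) (s ^ E)"

definition omega :: "real \<Rightarrow> nat \<Rightarrow> nat \<Rightarrow> nat \<Rightarrow> nat \<Rightarrow> nat \<Rightarrow> real" where
  "omega s A B C D E = suminf (omega_term s A B C D E)"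

text \<open>In terms of exponents of s: all parameters lie below 1, all lower parameters aq/b, ...,
  aq/e lie below 1, and the argument w = s^(2A + 2 - (B + C + D + E)) lies below 1.\<close>

definition admissible :: "nat \<Rightarrow> nat \<Rightarrow> nat \<Rightarrow> nat \<Rightarrow> nat \<Rightarrow> bool" where
  "admissible A B C D E \<longleftrightarrow> 0 < A \<and> 0 < B \<and> 0 < C \<and> 0 < D \<and> 0 < E
     \<and> B < A + 2 \<and> C < A + 2 \<and> D < A + 2 \<and> E < A + 2 \<and> B + C + D + E < 2 * A + 2"

text \<open>The recursion shifts the last parameter; this symmetry lets the last two take
  turns.\<close>

lemma omega_swap: "omega s A B C D E = omega s A B C E D"
  unfolding omega_def omega_term_def vwp_def wp_def by (simp add: mult_ac)

lemma power_quotient: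
  fixes s :: real
  assumes "0 < s" "B \<le> A + 2"
  shows "s ^ A * s\<^sup>2 / s ^ B = s ^ (A + 2 - B)"
  using assms by (simp add: power_diff flip: power_add)

lemma power_argument:
  fixes s :: real
  assumes "0 < s" "B + C + D + E \<le> 2 * A + 2"
  shows "s\<^sup>2 * (s ^ A)\<^sup>2 / (s ^ B * s ^ C * s ^ D * s ^ E) = s ^ (2 * A + 2 - (B + C + D + E))"
proof -
  have "s\<^sup>2 * (s ^ A)\<^sup>2 = s ^ (2 * A + 2)" by (simp add: power_add power_even_eq power2_eq_square)
  moreover have "s ^ B * s ^ C * s ^ D * s ^ E = s ^ (B + C + D + E)" by (simp add: power_add)
  ultimately show ?thesis using assms by (simp add: power_diff)
qed

text \<open>The term at k = 0 is exactly 1 - s^A, and the tail is dominated by a geometric series.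
  All lower parameters are positive powers of s, hence at most s, so \<open>wp_bounds\<close>
  applies with y = s and a constant independent of the exponents.\<close>

lemma omega_bounds:
  assumes s: "0 < s" "s < 1" and A: "admissible A B C D E"
    and w: "w = s ^ (2 * A + 2 - (B + C + D + E))"
  shows "summable (omega_term s A B C D E)"
    "(\<lambda>k. wp (s\<^sup>2) (s ^ A) (s ^ B) (s ^ C) (s ^ D) (s ^ E) k) \<longlonglongrightarrow> 0"
    "1 - s ^ A \<le> omega s A B C D E"
    "omega s A B C D E \<le> 1 - s ^ A + w / ((1 - w) * qpoch_inf s (s\<^sup>2) ^ 4)"
proof -
  define P where "P = qpoch_inf s (s\<^sup>2) ^ 4"
  define h where "h = wp (s\<^sup>2) (s ^ A) (s ^ B) (s ^ C) (s ^ D) (s ^ E)"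
  have q: "0 < s\<^sup>2" "s\<^sup>2 < 1" using s by (simp_all add: power_less_one_iff)
  have P: "0 < P" unfolding P_def using qpoch_ge(1)[OF q, of 0 s] s by simp
  have w1: "0 < w" "w < 1" unfolding w using s A by (auto simp: admissible_def power_less_one_iff)
  have le: "s ^ n \<le> s" if "0 < n" for n
    using power_decreasing[of 1 n s] s that by simp
  have ws: "w = s\<^sup>2 * (s ^ A)\<^sup>2 / (s ^ B * s ^ C * s ^ D * s ^ E)"
    using s A by (simp add: w power_argument admissible_def)
  have pq: "s ^ A * s\<^sup>2 / s ^ X = s ^ (A + 2 - X)" if "X < A + 2" for X
    using power_quotient[of s X A] s that by simp
  have h: "0 \<le> h k" "h k \<le> w ^ k / P" for k
    unfolding h_def P_def using A s
    by (auto intro!: wp_bounds[OF q s(2) _ _ _ _ _ _ _ _ _ _ _ _ _ _ _ _ ws] 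
        simp: pq admissible_def le power_le_one)
  let ?t = "omega_term s A B C D E"
  have t: "?t k = (1 - s ^ A * s\<^sup>2 ^ (2 * k)) * h k" for k
    by (simp add: omega_term_def vwp_def h_def)
  have f: "0 \<le> 1 - s ^ A * s\<^sup>2 ^ (2 * k)" "1 - s ^ A * s\<^sup>2 ^ (2 * k) \<le> 1" for k
    using s by (simp_all add: mult_le_one power_le_one)
  have t0: "0 \<le> ?t k" and t1: "?t k \<le> w ^ k / P" for k
    unfolding t using f[of k] h[of k] mult_right_mono[OF f(2) h(1), of k k]
    by (auto simp del: power_mult)
  have g: "summable (\<lambda>k. w ^ k / P)" using w1 by (intro summable_divide summable_geometric) simp
  show sm: "summable ?t" using t0 t1 by (intro summable_comparison_test'[OF g, of 0]) auto
  have "(\<lambda>k. w ^ k / P) \<longlonglongrightarrow> 0" using g by (rule summable_LIMSEQ_zero)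
  then show "(\<lambda>k. wp (s\<^sup>2) (s ^ A) (s ^ B) (s ^ C) (s ^ D) (s ^ E) k) \<longlonglongrightarrow> 0"
    using h unfolding h_def[symmetric] by (intro tendsto_sandwich[of "\<lambda>_. 0" h]) auto
  have t00: "?t 0 = 1 - s ^ A" by (simp add: t h_def wp_def)
  have split: "omega s A B C D E = (1 - s ^ A) + (\<Sum>k. ?t (Suc k))"
    unfolding omega_def using suminf_split_head[OF sm] t00 by simp
  have sm': "summable (\<lambda>k. ?t (Suc k))" using sm by (simp add: summable_Suc_iff)
  show "1 - s ^ A \<le> omega s A B C D E"
    unfolding split using suminf_nonneg[OF sm'] t0 by simp
  have g': "(\<lambda>k. w / P * w ^ k) sums (w / P * (1 / (1 - w)))"
    using w1 by (intro sums_mult geometric_sums) simp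
  have "(\<Sum>k. ?t (Suc k)) \<le> (\<Sum>k. w / P * w ^ k)"
    using t1[of "Suc _"] by (intro suminf_le sm' sums_summable[OF g']) simp
  then show "omega s A B C D E \<le> 1 - s ^ A + w / ((1 - w) * qpoch_inf s (s\<^sup>2) ^ 4)"
    unfolding split using sums_unique[OF g'] by (simp add: P_def mult.commute)
qed

text \<open>Sum \<open>vwp_telescope\<close> over k. The boundary terms tend to 0 together with
  \<open>wp\<close>, so only \<open>V 0\<close> survives. The inequalities in \<open>le\<close> keep
  the subtractions of exponents free of truncation.\<close>

lemma omega_step:
  assumes s: "0 < s" "s < 1" and A: "admissible A B C D E" "admissible (A + 2) B C D (E + 2)"
    and le: "E \<le> A" "B + C \<le> A + 2" "B + D \<le> A + 2" "C + D \<le> A + 2"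
    and W: "W = 2 * A + 2 - (B + C + D + E)"
  shows "omega s A B C D E = (1 - s ^ (A - E)) * (1 - s ^ (W + E)) / (1 - s ^ W)
    + s ^ (A - E) * (1 - s ^ E) * (1 - s ^ (A + 2 - (B + C))) * (1 - s ^ (A + 2 - (B + D)))
        * (1 - s ^ (A + 2 - (C + D)))
      / ((1 - s ^ W) * (1 - s ^ (A + 2 - B)) * (1 - s ^ (A + 2 - C)) * (1 - s ^ (A + 2 - D)))
      * omega s (A + 2) B C D (E + 2)"
proof -
  have q: "0 < s\<^sup>2" "s\<^sup>2 < 1" using s by (simp_all add: power_less_one_iff)
  have lt1: "s ^ n < 1" if "0 < n" for n using s that by (simp add: power_less_one_iff)
  have pq: "s ^ A * s\<^sup>2 / s ^ X = s ^ (A + 2 - X)" if "X \<le> A + 2" for X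
    using power_quotient[of s X A] s that by simp
  have ws: "s ^ W = s\<^sup>2 * (s ^ A)\<^sup>2 / (s ^ B * s ^ C * s ^ D * s ^ E)"
    using s A by (simp add: W power_argument admissible_def)
  have W0: "0 < W" using A by (simp add: W admissible_def)
  have ae: "s ^ A / s ^ E = s ^ (A - E)" using s le by (simp add: power_diff)
  have lA: "B \<le> A + 2" "C \<le> A + 2" "D \<le> A + 2" using A(1) by (auto simp: admissible_def)
  define r where "r = vwp_ratio (s\<^sup>2) (s ^ A) (s ^ B) (s ^ C) (s ^ D) (s ^ E)"
  define h where "h = wp (s\<^sup>2) (s ^ A) (s ^ B) (s ^ C) (s ^ D) (s ^ E)"
  define V where "V k = h k * (1 - (s\<^sup>2) ^ k * s ^ A / s ^ E) * (1 - s ^ W * s ^ E * (s\<^sup>2) ^ k) / (1 - s ^ W)" for k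
  have nz: "s ^ X \<noteq> 0" for X using s by simp
  have lt: "s ^ A * s\<^sup>2 / s ^ X < 1" if "X < A + 2" for X
    using pq[of X] lt1[of "A + 2 - X"] that by simp
  have ltE: "s ^ E < 1" and neW: "s ^ W \<noteq> 1"
    using lt1[of E] lt1[OF W0] A by (auto simp: admissible_def)
  have tel: "omega_term s A B C D E k = r * omega_term s (A + 2) B C D (E + 2) k + (V k - V (Suc k))" for k
    unfolding omega_term_def power_add[of s _ 2] r_def
    by (rule vwp_telescope[OF q nz nz nz nz nz ltE lt lt lt lt ws neW])
      (use A in \<open>simp_all add: admissible_def V_def h_def\<close>)
  have "h \<longlonglongrightarrow> 0" unfolding h_def by (rule omega_bounds(2)[OF s A(1) refl])
  moreover have "(\<lambda>k. (s\<^sup>2) ^ k) \<longlonglongrightarrow> 0" using q by (intro LIMSEQ_realpow_zero) auto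
  ultimately have "V \<longlonglongrightarrow> 0 * (1 - 0 * s ^ A / s ^ E) * (1 - s ^ W * s ^ E * 0) / (1 - s ^ W)"
    unfolding V_def using lt1[OF W0] s q by (intro tendsto_intros) auto
  then have "(\<lambda>k. V k - V (Suc k)) sums (V 0 - 0)" by (intro telescope_sums') simp
  moreover have "omega_term s (A + 2) B C D (E + 2) sums omega s (A + 2) B C D (E + 2)"
    unfolding omega_def by (intro summable_sums omega_bounds(1)[OF s A(2) refl])
  ultimately have "omega_term s A B C D E sums (r * omega s (A + 2) B C D (E + 2) + (V 0 - 0))"
    unfolding tel by (intro sums_add sums_mult)
  then have "omega s A B C D E = V 0 + r * omega s (A + 2) B C D (E + 2)"
    unfolding omega_def using sums_unique by fastforce
  moreover have "V 0 = (1 - s ^ (A - E)) * (1 - s ^ (W + E)) / (1 - s ^ W)"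
    by (simp add: V_def h_def wp_def ae power_add)
  moreover have "r = s ^ (A - E) * (1 - s ^ E) * (1 - s ^ (A + 2 - (B + C))) * (1 - s ^ (A + 2 - (B + D)))
        * (1 - s ^ (A + 2 - (C + D)))
      / ((1 - s ^ W) * (1 - s ^ (A + 2 - B)) * (1 - s ^ (A + 2 - C)) * (1 - s ^ (A + 2 - D)))"
    unfolding r_def vwp_ratio_def ws[symmetric]
    unfolding ae power_add[symmetric, of s B] power_add[symmetric, of s C]
      pq[OF le(2)] pq[OF le(3)] pq[OF le(4)] pq[OF lA(1)] pq[OF lA(2)] pq[OF lA(3)] by (rule refl)
  ultimately show ?thesis by (simp only:)
qed

section \<open>Evaluation of the initial series\<close>

lemma power_even_shift_tendsto_0:
  fixes s :: real
  assumes s: "0 < s" "s < 1"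
  shows "(\<lambda>n. s ^ (2 * n + k)) \<longlonglongrightarrow> 0"
proof -
  have "(\<lambda>n. (s\<^sup>2) ^ n * s ^ k) \<longlonglongrightarrow> 0 * s ^ k"
    using s by (intro tendsto_mult_right LIMSEQ_realpow_zero) (auto simp: power_less_one_iff)
  then show ?thesis by (simp add: power_add power_mult)
qed

lemma power_step: "(s\<^sup>2) ^ m * s ^ k = (s::real) ^ (2 * m + k)"
  by (simp add: power_add power_mult)

lemma power_step1: "(s\<^sup>2) ^ m * s = (s::real) ^ (2 * m + 1)"
  by (simp add: power_mult)

lemma omega_start:
  assumes s: "0 < s" "s < 1"
  shows "omega s 2 1 1 1 2 = qpoch_inf (s\<^sup>2) (s\<^sup>2) ^ 4 / (qpoch_inf s (s\<^sup>2) * qpoch_inf (s ^ 3) (s\<^sup>2) ^ 3)"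
proof -
  have q: "0 < s\<^sup>2" "s\<^sup>2 < 1" using s by (simp_all add: power_less_one_iff)
  define f where "f m = omega s (2 * m + 2) 1 1 1 (2 * m + 2)" for m
  define g where "g m = qpoch (s\<^sup>2) (s\<^sup>2) m ^ 4 / (qpoch s (s\<^sup>2) m * qpoch (s ^ 3) (s\<^sup>2) m ^ 3)" for m
  define P where "P = qpoch_inf s (s\<^sup>2) ^ 4"
  have "f 0 = g m * f m" for m
  proof (induction m)
    case (Suc m)
    \<comment> \<open>Here E = A, so the boundary term contains the factor 1 - s^0 = 0 and the
      recursion becomes purely multiplicative.\<close>
    have "f m = (1 - s ^ (2 * m + 2)) ^ 4 / ((1 - s ^ (2 * m + 1)) * (1 - s ^ (2 * m + 3)) ^ 3) * f (Suc m)"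
      unfolding f_def
      by (subst omega_step[OF s, where W = "2 * m + 1"])
        (simp_all add: admissible_def eval_nat_numeral mult_ac)
    moreover have "g (Suc m) = g m * ((1 - s ^ (2 * m + 2)) ^ 4 / ((1 - s ^ (2 * m + 1)) * (1 - s ^ (2 * m + 3)) ^ 3))"
      unfolding g_def qpoch_Suc power_mult_distrib power_step[of s m 2] power_step[of s m 3] power_step1[of s m]
      by (simp add: mult_ac)
    ultimately show ?case using Suc by simp
  qed (simp add: g_def)
  then have "(\<lambda>m. g m * f m) = (\<lambda>_. f 0)" by (simp add: fun_eq_iff)
  then have gf: "(\<lambda>m. g m * f m) \<longlonglongrightarrow> f 0" by simp
  \<comment> \<open>Along this sequence the argument is w = s^(2m + 1); it tends to 0, as does s^A,
    and both bounds of \<open>omega_bounds\<close> tend to 1.\<close>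
  have "f \<longlonglongrightarrow> 1"
  proof (rule tendsto_sandwich)
    have "admissible (2 * m + 2) 1 1 1 (2 * m + 2)" for m by (simp add: admissible_def)
    note b = omega_bounds(3,4)[OF s this refl]
    show "\<forall>\<^sub>F m in sequentially. 1 - s ^ (2 * m + 2) \<le> f m"
      unfolding f_def using b(1) by (intro always_eventually allI)
    have e: "2 * (2 * m + 2) + 2 - (1 + 1 + 1 + (2 * m + 2)) = 2 * m + 1" for m :: nat by simp
    show "\<forall>\<^sub>F m in sequentially. f m \<le> 1 - s ^ (2 * m + 2) + s ^ (2 * m + 1) / ((1 - s ^ (2 * m + 1)) * P)"
      unfolding f_def P_def using b(2) unfolding e by (intro always_eventually allI)
    have P: "P \<noteq> 0" unfolding P_def using qpoch_inf_nonzero[OF q s(2)] by simp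
    have "(\<lambda>m. 1 - s ^ (2 * m + 2)) \<longlonglongrightarrow> 1 - 0"
      by (intro tendsto_intros power_even_shift_tendsto_0 s)
    then show "(\<lambda>m. 1 - s ^ (2 * m + 2)) \<longlonglongrightarrow> 1" by simp
    have "(\<lambda>m. 1 - s ^ (2 * m + 2) + s ^ (2 * m + 1) / ((1 - s ^ (2 * m + 1)) * P)) \<longlonglongrightarrow> 1 - 0 + 0 / ((1 - 0) * P)"
      using P by (intro tendsto_intros power_even_shift_tendsto_0 s) auto
    then show "(\<lambda>m. 1 - s ^ (2 * m + 2) + s ^ (2 * m + 1) / ((1 - s ^ (2 * m + 1)) * P)) \<longlonglongrightarrow> 1" by simp
  qed
  moreover have "s ^ 3 < 1" using s by (simp add: power_less_one_iff)
  then have "g \<longlonglongrightarrow> qpoch_inf (s\<^sup>2) (s\<^sup>2) ^ 4 / (qpoch_inf s (s\<^sup>2) * qpoch_inf (s ^ 3) (s\<^sup>2) ^ 3)"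
    unfolding g_def using qpoch_inf_nonzero[OF q] s by (intro tendsto_intros qpoch_tendsto q) auto
  ultimately have "(\<lambda>m. g m * f m) \<longlonglongrightarrow> qpoch_inf (s\<^sup>2) (s\<^sup>2) ^ 4 / (qpoch_inf s (s\<^sup>2) * qpoch_inf (s ^ 3) (s\<^sup>2) ^ 3) * 1"
    by (intro tendsto_mult)
  then have "f 0 = qpoch_inf (s\<^sup>2) (s\<^sup>2) ^ 4 / (qpoch_inf s (s\<^sup>2) * qpoch_inf (s ^ 3) (s\<^sup>2) ^ 3)"
    using LIMSEQ_unique[OF gf] by simp
  then show ?thesis unfolding f_def by (simp only: mult_0_right add_0)
qed

section \<open>The accelerated series\<close>

text \<open>The product of the first n values of \<open>triple_ratio\<close> in closed form. The
  exponent is the sum of (2m + 1) + (4m + 3) + (2m + 3) = 8m + 7 over m < n.\<close>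

definition lam :: "real \<Rightarrow> nat \<Rightarrow> real" where
  "lam s n = s ^ (4 * n\<^sup>2 + 3 * n)
     * (qpoch (s\<^sup>2) (s\<^sup>2) n * qpoch s (s\<^sup>2) n ^ 2 * qpoch (s\<^sup>2) (s\<^sup>2) (2 * n) * qpoch s (s\<^sup>2) (2 * n) ^ 2)
     / (qpoch (s ^ 3) (s\<^sup>2) n * qpoch (s ^ 3) (s\<^sup>2) (2 * n) * qpoch (s\<^sup>2) (s\<^sup>2) (3 * n) * qpoch (s ^ 3) (s\<^sup>2) (3 * n))"

text \<open>Along the path of parameters used below the last two exponents add up to the first one,
  which cancels one factor of the general ratio.\<close>

definition step_bdry :: "real \<Rightarrow> nat \<Rightarrow> nat \<Rightarrow> real" where
  "step_bdry s D E = (1 - s ^ D) * (1 - s ^ (D + 2 * E - 1)) / (1 - s ^ (D + E - 1))"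

definition step_ratio :: "real \<Rightarrow> nat \<Rightarrow> nat \<Rightarrow> real" where
  "step_ratio s D E = s ^ D * (1 - s ^ E)\<^sup>2 * (1 - s ^ (E + 1))
     / ((1 - s ^ (D + E)) * (1 - s ^ (D + E + 1)) * (1 - s ^ (E + 2)))"

lemma omega_balanced_step:
  assumes s: "0 < s" "s < 1" and DE: "0 < D" "0 < E"
  shows "omega s (D + E) 1 2 D E = step_bdry s D E + step_ratio s D E * omega s (D + E + 2) 1 2 D (E + 2)"
proof -
  have e: "D + E - E = D" "D + E + 2 - (1 + 2) = D + E - 1" "D + E + 2 - (1 + D) = E + 1"
    "D + E + 2 - (2 + D) = E" "D + E + 2 - 1 = D + E + 1" "D + E + 2 - 2 = D + E"
    "D + E + 2 - D = E + 2" "D + E - 1 + E = D + 2 * E - 1" using DE by simp_all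
  have W: "1 - s ^ (D + E - 1) \<noteq> 0"
    using power_less_one_iff[of s "D + E - 1"] s DE by auto
  \<comment> \<open>The exponent W of the argument and the exponent A + 2 - (B + C) both equal D + E
    - 1; \<open>z\<close> is the common factor that cancels.\<close>
  have c: "v * y * z * w * y / (z * a * b * c) = v * y\<^sup>2 * w / (b * a * c)"
    if "z \<noteq> 0" for v w y z a b c :: real
    using that by (simp add: power2_eq_square mult_ac)
  have "omega s (D + E) 1 2 D E = (1 - s ^ D) * (1 - s ^ (D + 2 * E - 1)) / (1 - s ^ (D + E - 1))
      + s ^ D * (1 - s ^ E) * (1 - s ^ (D + E - 1)) * (1 - s ^ (E + 1)) * (1 - s ^ E)
        / ((1 - s ^ (D + E - 1)) * (1 - s ^ (D + E + 1)) * (1 - s ^ (D + E)) * (1 - s ^ (E + 2)))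
        * omega s (D + E + 2) 1 2 D (E + 2)"
    by (rule omega_step[OF s, where A = "D + E" and W = "D + E - 1" and B = 1 and C = 2 and D = D and E = E, unfolded e])
      (use DE in \<open>auto simp: admissible_def\<close>)
  then show ?thesis unfolding c[OF W] step_bdry_def step_ratio_def .
qed

section \<open>Three steps of the recursion, from index n to n + 1, and their telescoping
  sum\<close>

definition triple_bdry :: "real \<Rightarrow> nat \<Rightarrow> real" where
  "triple_bdry s n = step_bdry s (2 * n + 1) (4 * n + 1)
    + step_ratio s (2 * n + 1) (4 * n + 1) * (step_bdry s (4 * n + 3) (2 * n + 1)
    + step_ratio s (4 * n + 3) (2 * n + 1) * step_bdry s (2 * n + 3) (4 * n + 3))"

definition triple_ratio :: "real \<Rightarrow> nat \<Rightarrow> real" where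
  "triple_ratio s n = step_ratio s (2 * n + 1) (4 * n + 1) * step_ratio s (4 * n + 3) (2 * n + 1)
    * step_ratio s (2 * n + 3) (4 * n + 3)"

text \<open>The last two exponents run from (2n+1, 4n+1) through (2n+1, 4n+3) and (2n+3, 4n+3) to
  (2n+3, 4n+5). Between steps \<open>omega_swap\<close> moves the exponent to be raised into the
  last place.\<close>

lemma omega_recursion:
  assumes s: "0 < s" "s < 1"
  shows "omega s (6 * n + 2) 1 2 (2 * n + 1) (4 * n + 1)
    = triple_bdry s n + triple_ratio s n * omega s (6 * Suc n + 2) 1 2 (2 * Suc n + 1) (4 * Suc n + 1)"
proof -
  have e: "2 * n + 1 + (4 * n + 1) = 6 * n + 2" "6 * n + 2 + 2 = 6 * n + 4" "4 * n + 1 + 2 = 4 * n + 3"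
    "4 * n + 3 + (2 * n + 1) = 6 * n + 4" "6 * n + 4 + 2 = 6 * n + 6" "2 * n + 1 + 2 = 2 * n + 3"
    "2 * n + 3 + (4 * n + 3) = 6 * n + 6" "6 * n + 6 + 2 = 6 * Suc n + 2" "4 * n + 3 + 2 = 4 * Suc n + 1"
    "2 * n + 3 = 2 * Suc n + 1" by simp_all
  have p: "0 < 2 * n + 3" "0 < 4 * n + 3" by simp_all
  note r = omega_balanced_step[OF s]
  have "omega s (6 * n + 2) 1 2 (2 * n + 1) (4 * n + 1) = step_bdry s (2 * n + 1) (4 * n + 1)
      + step_ratio s (2 * n + 1) (4 * n + 1) * omega s (6 * n + 4) 1 2 (4 * n + 3) (2 * n + 1)"
    using r[of "2 * n + 1" "4 * n + 1"] omega_swap[of s _ _ _ "4 * n + 3"] unfolding e by simp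
  also have "omega s (6 * n + 4) 1 2 (4 * n + 3) (2 * n + 1) = step_bdry s (4 * n + 3) (2 * n + 1)
      + step_ratio s (4 * n + 3) (2 * n + 1) * omega s (6 * n + 6) 1 2 (2 * n + 3) (4 * n + 3)"
    using r[of "4 * n + 3" "2 * n + 1"] omega_swap[of s _ _ _ "2 * n + 3"] unfolding e(1-9) by simp
  also have "omega s (6 * n + 6) 1 2 (2 * n + 3) (4 * n + 3) = step_bdry s (2 * n + 3) (4 * n + 3)
      + step_ratio s (2 * n + 3) (4 * n + 3) * omega s (6 * Suc n + 2) 1 2 (2 * Suc n + 1) (4 * Suc n + 1)"
    using r[OF p] unfolding e(7-9) unfolding e(10) by (simp only:)
  finally show ?thesis unfolding triple_bdry_def triple_ratio_def by (simp only: distrib_left mult.assoc add.assoc)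
qed

text \<open>Passing to n + 1 lengthens the symbols by one, two or three factors. Written as
  \<open>u\<close> of their exponents, these are the factors of the three step ratios; the exponents
  6n+2 to 6n+7 come from the symbols of length 3n.\<close>

lemma lam_Suc: "lam s (Suc n) = lam s n * triple_ratio s n"
proof -
  define u where "u k = 1 - s ^ k" for k
  have S: "qpoch (s ^ j) (s\<^sup>2) (Suc k) = qpoch (s ^ j) (s\<^sup>2) k * u (2 * k + j)" for j k
    by (simp add: qpoch_Suc u_def power_add flip: power_mult)
  have S1: "qpoch s (s\<^sup>2) (Suc k) = qpoch s (s\<^sup>2) k * u (2 * k + 1)" for k
    using S[of 1] by simp
  have m: "2 * Suc n = Suc (Suc (2 * n))" "3 * Suc n = Suc (Suc (Suc (3 * n)))" by simp_all
  have p: "s ^ (4 * (Suc n)\<^sup>2 + 3 * Suc n) = s ^ (4 * n\<^sup>2 + 3 * n) * (s ^ (2 * n + 1) * s ^ (4 * n + 3) * s ^ (2 * n + 3))"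
  proof -
    have "4 * (Suc n)\<^sup>2 + 3 * Suc n = 4 * n\<^sup>2 + 3 * n + (2 * n + 1 + (4 * n + 3) + (2 * n + 3))"
      by (simp add: power2_eq_square)
    then show ?thesis by (simp only: power_add)
  qed
  have e: "2 * n + 1 + (4 * n + 1) = 6 * n + 2" "4 * n + 3 + (2 * n + 1) = 6 * n + 4"
    "2 * n + 3 + (4 * n + 3) = 6 * n + 6" "2 * n + 1 + 1 = 2 * n + 2" "4 * n + 1 + 1 = 4 * n + 2"
    "2 * n + 1 + 2 = 2 * n + 3" "4 * n + 1 + 2 = 4 * n + 3" "4 * n + 3 + 1 = 4 * n + 4" "4 * n + 3 + 2 = 4 * n + 5"
    "6 * n + 2 + 1 = 6 * n + 3" "6 * n + 4 + 1 = 6 * n + 5" "6 * n + 6 + 1 = 6 * n + 7" by simp_all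
  have a: "2 * (2 * n) + k = 4 * n + k" "2 * Suc (2 * n) + k = 4 * n + (2 + k)"
    "2 * (3 * n) + k = 6 * n + k" "2 * Suc (3 * n) + k = 6 * n + (2 + k)"
    "2 * Suc (Suc (3 * n)) + k = 6 * n + (4 + k)" for k by simp_all
  show ?thesis
    unfolding lam_def triple_ratio_def step_ratio_def e p
    unfolding m S S1 a u_def[symmetric]
    by (simp add: power_mult_distrib divide_inverse mult_ac)
qed

text \<open>The q-shifted factorials contribute a bounded quotient, so the power of s forces the
  decay; its exponent is at least n.\<close>

lemma lam_tendsto_0:
  assumes s: "0 < s" "s < 1"
  shows "lam s \<longlonglongrightarrow> 0"
proof -
  have q: "0 < s\<^sup>2" "s\<^sup>2 < 1" using s by (simp_all add: power_less_one_iff)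
  define P where "P = qpoch_inf s (s\<^sup>2)"
  have P: "0 < P" unfolding P_def using qpoch_ge(1)[OF q, of 0 s] s by simp
  have le: "s ^ j \<le> s" if "0 < j" for j
    using power_decreasing[of 1 j s] s that by simp
  have b: "0 \<le> qpoch (s ^ j) (s\<^sup>2) k" "qpoch (s ^ j) (s\<^sup>2) k \<le> 1" "P \<le> qpoch (s ^ j) (s\<^sup>2) k"
    if "0 < j" for j k
    unfolding P_def using qpoch_bounds[OF q, of "s ^ j" k] qpoch_ge(2)[OF q, of "s ^ j" s k] le[OF that] s
    by simp_all
  note b1 = b[of 1, simplified]
  have N0: "0 \<le> s ^ (4 * n\<^sup>2 + 3 * n) * (qpoch (s\<^sup>2) (s\<^sup>2) n * qpoch s (s\<^sup>2) n ^ 2 * qpoch (s\<^sup>2) (s\<^sup>2) (2 * n) * qpoch s (s\<^sup>2) (2 * n) ^ 2)" for n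
    using b(1)[of 2] b1(1) s by simp
  have N1: "s ^ (4 * n\<^sup>2 + 3 * n) * (qpoch (s\<^sup>2) (s\<^sup>2) n * qpoch s (s\<^sup>2) n ^ 2 * qpoch (s\<^sup>2) (s\<^sup>2) (2 * n) * qpoch s (s\<^sup>2) (2 * n) ^ 2) \<le> s ^ n" for n
  proof -
    have "qpoch (s\<^sup>2) (s\<^sup>2) n * qpoch s (s\<^sup>2) n ^ 2 * qpoch (s\<^sup>2) (s\<^sup>2) (2 * n) * qpoch s (s\<^sup>2) (2 * n) ^ 2 \<le> 1"
      using b(1,2)[of 2] b1(1,2) by (intro mult_le_one mult_nonneg_nonneg power_le_one zero_le_power) simp_all
    moreover have "s ^ (4 * n\<^sup>2 + 3 * n) \<le> s ^ n" using s by (intro power_decreasing) auto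
    ultimately show ?thesis
      using mult_mono[of "s ^ (4 * n\<^sup>2 + 3 * n)" "s ^ n" _ 1] b(1)[of 2] b1(1) s by simp
  qed
  have D: "P ^ 4 \<le> qpoch (s ^ 3) (s\<^sup>2) n * qpoch (s ^ 3) (s\<^sup>2) (2 * n) * qpoch (s\<^sup>2) (s\<^sup>2) (3 * n) * qpoch (s ^ 3) (s\<^sup>2) (3 * n)" for n
    unfolding power4_eq_xxxx using b(1,3)[of 2] b(1,3)[of 3] P
    by (intro mult_mono mult_nonneg_nonneg) simp_all
  have bound: "0 \<le> lam s n \<and> lam s n \<le> s ^ n / P ^ 4" for n
  proof
    have "0 < P ^ 4" using P by simp
    then show "0 \<le> lam s n" unfolding lam_def using N0[of n] D[of n] by (intro divide_nonneg_nonneg) linarith+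
    show "lam s n \<le> s ^ n / P ^ 4"
      unfolding lam_def using N0[of n] N1[of n] D[of n] \<open>0 < P ^ 4\<close> s by (intro frac_le) auto
  qed
  have "(\<lambda>n. s ^ n / P ^ 4) \<longlonglongrightarrow> 0 / P ^ 4"
    using P s by (intro tendsto_divide LIMSEQ_realpow_zero tendsto_const) auto
  then show ?thesis using bound by (intro tendsto_sandwich[of "\<lambda>_. 0" "lam s"]) auto
qed

lemma accelerated_sums:
  assumes s: "0 < s" "s < 1"
  shows "(\<lambda>n. lam s n * triple_bdry s n) sums omega s 2 1 2 1 1"
proof -
  define f where "f n = omega s (6 * n + 2) 1 2 (2 * n + 1) (4 * n + 1)" for n
  have q: "0 < s\<^sup>2" "s\<^sup>2 < 1" using s by (simp_all add: power_less_one_iff)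
  define P where "P = qpoch_inf s (s\<^sup>2) ^ 4"
  have P: "0 < P" unfolding P_def using qpoch_ge(1)[OF q, of 0 s] s by simp
  have "lam s n * triple_bdry s n = lam s n * f n - lam s (Suc n) * f (Suc n)" for n
    using omega_recursion[OF s, of n] unfolding lam_Suc f_def[symmetric] by (simp add: algebra_simps)
  moreover have "(\<lambda>n. lam s n * f n) \<longlonglongrightarrow> 0"
  proof (rule Lim_null_comparison)
    \<comment> \<open>The exponent of the argument is 6n + 1, so the argument stays at most s and
      the upper bound of \<open>omega_bounds\<close> is uniform in n.\<close>
    have "0 \<le> f n \<and> f n \<le> 1 + 1 / ((1 - s) * P)" for n
    proof -
      have "admissible (6 * n + 2) 1 2 (2 * n + 1) (4 * n + 1)" by (simp add: admissible_def)
      note b = omega_bounds(3,4)[OF s this refl, folded f_def P_def]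
      let ?w = "s ^ (2 * (6 * n + 2) + 2 - (1 + 2 + (2 * n + 1) + (4 * n + 1)))"
      have "?w \<le> s ^ 1" using s by (intro power_decreasing) auto
      then have "?w \<le> s" by (simp only: power_one_right)
      then have "?w / ((1 - ?w) * P) \<le> 1 / ((1 - s) * P)"
        using s P by (intro frac_le mult_right_mono mult_pos_pos) linarith+
      then have "f n \<le> 1 + 1 / ((1 - s) * P)" using b(2) s by (smt (verit) zero_less_power)
      then show ?thesis using b(1) power_le_one[of s "6 * n + 2"] s by linarith
    qed
    then have "norm (lam s n * f n) \<le> \<bar>lam s n\<bar> * (1 + 1 / ((1 - s) * P))" for n
      by (simp add: abs_mult mult_left_mono)
    then show "\<forall>\<^sub>F n in sequentially. norm (lam s n * f n) \<le> \<bar>lam s n\<bar> * (1 + 1 / ((1 - s) * P))"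
      by simp
    show "(\<lambda>n. \<bar>lam s n\<bar> * (1 + 1 / ((1 - s) * P))) \<longlonglongrightarrow> 0"
      using lam_tendsto_0[OF s] by (intro tendsto_mult_left_zero tendsto_rabs_zero)
  qed
  then have "(\<lambda>n. lam s n * f n - lam s (Suc n) * f (Suc n)) sums (lam s 0 * f 0 - 0)"
    by (rule telescope_sums')
  moreover have "f 0 = omega s 2 1 2 1 1" unfolding f_def by (simp only: mult_0_right add_0)
  moreover have "lam s 0 = 1" by (simp add: lam_def)
  ultimately show ?thesis by (simp only: mult_1 diff_zero)
qed

text \<open>The parameters are those of \<open>omega_start\<close> in another order. The factor (1 -
  s)^2 comes from trading two of the three infinite products with base s^3 for products with base
  s.\<close>

lemma omega_value:
  assumes s: "0 < s" "s < 1"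
  shows "omega s 2 1 2 1 1 = (1 - s)\<^sup>2 * (qpoch_inf (s\<^sup>2) (s\<^sup>2) ^ 4 / (qpoch_inf s (s\<^sup>2) ^ 3 * qpoch_inf (s ^ 3) (s\<^sup>2)))"
proof -
  have q: "0 < s\<^sup>2" "s\<^sup>2 < 1" "s ^ 3 < 1" using s by (simp_all add: power_less_one_iff)
  have "omega s 2 1 2 1 1 = omega s 2 1 1 1 2"
    unfolding omega_def omega_term_def vwp_def wp_def by (simp add: mult_ac)
  moreover have "qpoch_inf s (s\<^sup>2) = (1 - s) * qpoch_inf (s ^ 3) (s\<^sup>2)"
    using qpoch_inf_shift[OF q(1,2), of s] by (simp add: eval_nat_numeral)
  ultimately show ?thesis
    unfolding omega_start[OF s] using s qpoch_inf_nonzero[OF q(1,2,3)]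
    by (simp add: divide_simps) (simp add: eval_nat_numeral)
qed

section \<open>Translation into the summands and the value of part (i)\<close>

lemma q_series:
  fixes q :: real
  assumes "0 < q" "q < 1"
  shows "(\<lambda>n::nat.
      q powr (2 * real n ^ 2 + 3 * real n / 2)
      * (qpochs [q, q powr (1/2), q powr (1/2)] q n
          * qpochs [q, q powr (3/2), q powr (3/2)] q (2 * n)
          * (1 - q ^ (2 * n + 1)) * (1 - q ^ (4 * n + 2)))
      / (qpoch (q powr (3/2)) q n * qpoch (q powr (3/2)) q (2 * n)
          * qpochs [q, q powr (3/2)] q (3 * n)
          * (1 - q ^ (3 * n + 1)) * (1 - q powr (3 * real n + 3/2)) ^ 2)
      * (q powr (real n + 1/2)
         + ((1 - q powr (real n + 1/2)) * (1 - q ^ (3 * n + 1))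
              * (1 - q powr (3 * real n + 3/2)) ^ 2 * (1 - q ^ (5 * n + 1)))
           / ((1 - q ^ (2 * n + 1)) * (1 - q powr (2 * real n + 1/2)) ^ 2
              * (1 - q powr (3 * real n + 1/2)) * (1 - q ^ (4 * n + 2)))
         + q ^ (3 * n + 2)
           * ((1 - q powr (real n + 1/2)) ^ 2 * (1 - q ^ (n + 1))
              * (1 - q powr (3 * real n + 3/2)) * (1 - q ^ (5 * n + 4)))
           / ((1 - q ^ (3 * n + 2)) * (1 - q powr (2 * real n + 3/2))
              * (1 - q powr (3 * real n + 5/2)) ^ 2 * (1 - q ^ (4 * n + 2)))))
    sums (qpoch_inf q q ^ 4
          / (qpoch_inf (q powr (1/2)) q ^ 3 * qpoch_inf (q powr (3/2)) q))"
    (is "?t sums ?S")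
proof -
  \<comment> \<open>With s = sqrt q every half-integral power of q becomes a natural power of
    s.\<close>
  define s where "s = sqrt q"
  have s: "0 < s" "s < 1" using assms by (auto simp: s_def)
  have qs: "q = s\<^sup>2" using assms by (simp add: s_def)
  have pw: "q powr x = s ^ k" if "2 * x = real k" for x k
  proof -
    have "q = s powr 2" using s by (simp add: qs powr_numeral)
    then have "q powr x = s powr (2 * x)" by (simp add: powr_powr)
    then show ?thesis using s that by (simp add: powr_realpow)
  qed
  have pn: "q ^ k = s ^ (2 * k)" for k by (simp add: qs power_mult)
  define u where "u k = 1 - s ^ k" for k
  have u: "u k \<noteq> 0" if "0 < k" for k
    using power_less_one_iff[of s k] s that by (auto simp: u_def)
  have u0: "1 - s \<noteq> 0" using s by simp
  have p1: "q powr (1/2) = s" using pw[of "1/2" 1] by simp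
  have p3: "q powr (3/2) = s ^ 3" by (rule pw) simp
  \<comment> \<open>The stated summand has (q^(3/2);q)_(2n) in the numerator where
    \<open>lam\<close> has (q^(1/2);q)_(2n). Converting two such symbols produces (1 - s)^(-2),
    which matches the factor in \<open>omega_value\<close>.\<close>
  have shift: "qpoch (s ^ 3) (s\<^sup>2) (2 * n) = qpoch s (s\<^sup>2) (2 * n) * u (4 * n + 1) / (1 - s)" for n
  proof -
    have "(1 - s) * qpoch (s ^ 3) (s\<^sup>2) (2 * n) = qpoch s (s\<^sup>2) (2 * n) * u (4 * n + 1)"
      using qpoch_shift[of s "s\<^sup>2" "2 * n"] unfolding power_step1 u_def
      by (simp add: power3_eq_cube power2_eq_square mult.assoc)
    then show ?thesis using u0 by (simp add: field_simps)
  qed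
  have summand: "?t n = lam s n * triple_bdry s n / (1 - s)\<^sup>2" for n
  proof -
    have e: "q powr (2 * real n ^ 2 + 3 * real n / 2) = s ^ (4 * n\<^sup>2 + 3 * n)"
      "q powr (real n + 1/2) = s ^ (2 * n + 1)" "q powr (3 * real n + 3/2) = s ^ (6 * n + 3)"
      "q powr (2 * real n + 1/2) = s ^ (4 * n + 1)" "q powr (3 * real n + 1/2) = s ^ (6 * n + 1)"
      "q powr (2 * real n + 3/2) = s ^ (4 * n + 3)" "q powr (3 * real n + 5/2) = s ^ (6 * n + 5)"
      by (rule pw; simp)+
    have d: "2 * (2 * n + 1) = 4 * n + 2" "2 * (4 * n + 2) = 8 * n + 4" "2 * (3 * n + 1) = 6 * n + 2"
      "2 * (5 * n + 1) = 10 * n + 2" "2 * (3 * n + 2) = 6 * n + 4" "2 * (n + 1) = 2 * n + 2"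
      "2 * (5 * n + 4) = 10 * n + 8" by simp_all
    define Qn where "Qn = qpoch (s\<^sup>2) (s\<^sup>2) n"
    define Sn where "Sn = qpoch s (s\<^sup>2) n"
    define Q2 where "Q2 = qpoch (s\<^sup>2) (s\<^sup>2) (2 * n)"
    define S2 where "S2 = qpoch s (s\<^sup>2) (2 * n)"
    define T where "T = qpoch (s ^ 3) (s\<^sup>2) n"
    define T2 where "T2 = qpoch (s ^ 3) (s\<^sup>2) (2 * n)"
    define Q3 where "Q3 = qpoch (s\<^sup>2) (s\<^sup>2) (3 * n)"
    define T3 where "T3 = qpoch (s ^ 3) (s\<^sup>2) (3 * n)"
    define L where "L = lam s n"
    \<comment> \<open>The factor in front of the braces, expressed through \<open>lam\<close>. It is
      normalised so that the boundary term of the middle step contributes exactly q^(n +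
      1/2).\<close>
    define R where "R = L * (u (4 * n + 1))\<^sup>2 * u (4 * n + 2) * u (8 * n + 4) / (u (6 * n + 2) * (u (6 * n + 3))\<^sup>2) / (1 - s)\<^sup>2"
    have pre: "s ^ (4 * n\<^sup>2 + 3 * n) * (Qn * Sn * Sn * (Q2 * T2 * T2) * u (4 * n + 2) * u (8 * n + 4))
      / (T * T2 * (Q3 * T3) * u (6 * n + 2) * (u (6 * n + 3))\<^sup>2) = R"
    proof -
      have T2s: "Q2 * T2 * T2 = Q2 * (S2 * S2) * (u (4 * n + 1) * u (4 * n + 1)) / ((1 - s) * (1 - s))"
        unfolding T2_def S2_def shift by (simp add: mult_ac)
      show ?thesis unfolding T2s unfolding R_def L_def lam_def Qn_def[symmetric] Sn_def[symmetric] Q2_def[symmetric]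
        S2_def[symmetric] T_def[symmetric] T2_def[symmetric] Q3_def[symmetric] T3_def[symmetric]
        by (simp add: power2_eq_square mult_ac)
    qed
    have f: "2 * n + 1 + 2 * (4 * n + 1) - 1 = 10 * n + 2" "2 * n + 1 + (4 * n + 1) - 1 = 6 * n + 1"
      "4 * n + 3 + 2 * (2 * n + 1) - 1 = 8 * n + 4" "4 * n + 3 + (2 * n + 1) - 1 = 6 * n + 3"
      "2 * n + 3 + 2 * (4 * n + 3) - 1 = 10 * n + 8" "2 * n + 3 + (4 * n + 3) - 1 = 6 * n + 5"
      "2 * n + 1 + (4 * n + 1) = 6 * n + 2" "4 * n + 3 + (2 * n + 1) = 6 * n + 4" "4 * n + 1 + 1 = 4 * n + 2"
      "2 * n + 1 + 1 = 2 * n + 2" "4 * n + 1 + 2 = 4 * n + 3" "2 * n + 1 + 2 = 2 * n + 3"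
      "6 * n + 2 + 1 = 6 * n + 3" "6 * n + 4 + 1 = 6 * n + 5"
      by simp_all
    \<comment> \<open>The third boundary term carries the powers s^D of the two preceding step
      ratios; their product is the q^(3n + 2) in the braces.\<close>
    have g: "s ^ (6 * n + 4) = s ^ (2 * n + 1) * s ^ (4 * n + 3)"
    proof -
      have "6 * n + 4 = 2 * n + 1 + (4 * n + 3)" by simp
      then show ?thesis by (simp only: power_add)
    qed
    have "?t n = R * (s ^ (2 * n + 1)
        + u (2 * n + 1) * u (6 * n + 2) * (u (6 * n + 3))\<^sup>2 * u (10 * n + 2)
          / (u (4 * n + 2) * (u (4 * n + 1))\<^sup>2 * u (6 * n + 1) * u (8 * n + 4))
        + s ^ (6 * n + 4) * ((u (2 * n + 1))\<^sup>2 * u (2 * n + 2) * u (6 * n + 3) * u (10 * n + 8))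
          / (u (6 * n + 4) * u (4 * n + 3) * (u (6 * n + 5))\<^sup>2 * u (8 * n + 4)))"
      unfolding pre[symmetric] e p1 p3 pn d qpochs_def
      by (simp add: u_def Qn_def Sn_def Q2_def T2_def T_def Q3_def T3_def qs)
    also have "\<dots> = L * triple_bdry s n / (1 - s)\<^sup>2"
      unfolding triple_bdry_def step_bdry_def step_ratio_def f u_def[symmetric] R_def
      unfolding g
      using u u0 by (simp add: divide_simps) (simp add: algebra_simps power2_eq_square)
    finally show ?thesis by (simp only: L_def)
  qed
  have "(\<lambda>n. lam s n * triple_bdry s n / (1 - s)\<^sup>2) sums (omega s 2 1 2 1 1 / (1 - s)\<^sup>2)"
    by (intro sums_divide accelerated_sums s)
  moreover have "omega s 2 1 2 1 1 / (1 - s)\<^sup>2 = ?S"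
    unfolding omega_value[OF s] p1 p3 using u0 by (simp add: qs)
  ultimately show ?thesis unfolding summand by simp
qed

section \<open>The classical case\<close>

lemma tendsto_inverse_linear:
  fixes c :: real
  assumes "1 \<le> c"
  shows "(\<lambda>k. 1 / (1 + c * real k)) \<longlonglongrightarrow> 0"
proof (rule Lim_null_comparison[OF _ LIMSEQ_inverse_real_of_nat])
  have "real k \<le> c * real k" for k using assms by (simp add: mult_left_le_imp_le mult_le_cancel_right1)
  then show "\<forall>\<^sub>F k in sequentially. norm (1 / (1 + c * real k)) \<le> inverse (real (Suc k))"
    using assms by (intro always_eventually allI) (simp add: inverse_eq_divide frac_le)
qed


text \<open>The term of the classical series with parameters \<open>(D + E)/2; 1/2, 1, D/2, E/2\<close>, where the duplication
  formula turns \<open>(1/2)\<^sub>k (1)\<^sub>k\<close> and \<open>((D+E)/2)\<^sub>k ((D+E+1)/2)\<^sub>k\<close> into Pochhammer symbols of length \<open>2k\<close>.\<close>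

definition cl_wp :: "real \<Rightarrow> real \<Rightarrow> nat \<Rightarrow> real" where
  "cl_wp D E k = pochhammer 1 (2 * k) * D * E
     / (pochhammer (D + E) (2 * k) * (D + 2 * real k) * (E + 2 * real k))"

text \<open>The factor is a + 2k with a = (D + E)/2, the limit of (1 - q^(a + 2k))/(1 - q). In
  \<open>cl_wp\<close> the symbols of D/2 and E/2 collapse to a rational function, because a + 1 -
  D/2 = E/2 + 1 and conversely.\<close>

definition cl_term :: "real \<Rightarrow> real \<Rightarrow> nat \<Rightarrow> real" where
  "cl_term D E k = (D + E + 4 * real k) / 2 * cl_wp D E k"

definition cl_omega :: "real \<Rightarrow> real \<Rightarrow> real" where
  "cl_omega D E = suminf (cl_term D E)"

text \<open>\<open>cl_bdry\<close> is the limit of \<open>step_bdry\<close> divided by 1 - s^2 as s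
  tends to 1, and \<open>cl_ratio\<close> is the limit of \<open>step_ratio\<close>.\<close>

definition cl_bdry :: "real \<Rightarrow> real \<Rightarrow> real" where
  "cl_bdry D E = D * (D + 2 * E - 1) / (2 * (D + E - 1))"

definition cl_ratio :: "real \<Rightarrow> real \<Rightarrow> real" where
  "cl_ratio D E = E\<^sup>2 * (E + 1) / ((D + E) * (D + E + 1) * (E + 2))"

lemma pochhammer_double_Suc:
  "pochhammer x (2 * Suc k) = pochhammer x (2 * k) * (x + 2 * real k) * (x + 2 * real k + 1)"
  by (simp add: pochhammer_Suc add.assoc add.commute)

lemma pochhammer_double_shift:
  assumes "(x::real) > 0"
  shows "pochhammer (x + 2) (2 * k) = pochhammer x (2 * k) * (x + 2 * real k) * (x + 2 * real k + 1) / (x * (x + 1))"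
proof (induction k)
  case (Suc k)
  have "x + 2 * real k > 0" using assms by simp
  then show ?case unfolding pochhammer_double_Suc Suc using assms by (simp add: field_simps)
qed (use assms in simp)

text \<open>\<open>V\<close> is the limit of the q-analogue's boundary term. After division by a
  common factor \<open>c\<close>, each of \<open>cl_term D E k - V k\<close> and
  \<open>cl_ratio D E * cl_term D (E + 2) k - V (Suc k)\<close> reduces to the same rational
  function of x = 2k.\<close>

lemma cl_telescope:
  assumes "1 \<le> D" "1 \<le> E"
    and V: "\<And>k. V k = cl_wp D E k * (D + 2 * real k) * (D + 2 * E - 1 + 2 * real k) / (2 * (D + E - 1))"
  shows "cl_term D E k = cl_ratio D E * cl_term D (E + 2) k + (V k - V (Suc k))"
proof -
  define x where "x = 2 * real k"
  have x: "x \<ge> 0" by (simp add: x_def)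
  define p where "p = pochhammer 1 (2 * k) / pochhammer (D + E) (2 * k)"
  have P: "pochhammer (D + E) (2 * k) \<noteq> 0"
    using assms pochhammer_pos[of "D + E" "2 * k"] by simp
  have nz: "D + x \<noteq> 0" "E + x \<noteq> 0" "E + x + 2 \<noteq> 0" "D + x + 2 \<noteq> 0" "D + E + x \<noteq> 0" "D + E + x + 1 \<noteq> 0" "D + E - 1 \<noteq> 0"
    "D + E + 1 \<noteq> 0" "E + 2 \<noteq> 0" "D + E \<noteq> 0"
    using assms x by linarith+
  have 1: "cl_wp D E k = p * D * E / ((D + x) * (E + x))"
    by (simp add: cl_wp_def p_def x_def)
  have 2: "cl_wp D E (Suc k) = p * (1 + x) * (2 + x) / ((D + E + x) * (D + E + x + 1)) * D * E / ((D + x + 2) * (E + x + 2))"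
    unfolding cl_wp_def pochhammer_double_Suc p_def x_def[symmetric] by (simp add: x_def algebra_simps)
  have 3: "cl_wp D (E + 2) k = p * (D + E) * (D + E + 1) / ((D + E + x) * (D + E + x + 1)) * D * (E + 2) / ((D + x) * (E + x + 2))"
  proof -
    have "D + (E + 2) = (D + E) + 2" "0 < D + E" using assms by simp_all
    then have ph: "pochhammer (D + (E + 2)) (2 * k) = pochhammer (D + E) (2 * k) * (D + E + x) * (D + E + x + 1) / ((D + E) * (D + E + 1))"
      by (simp only: pochhammer_double_shift x_def)
    have e: "E + 2 + x = E + x + 2" by simp
    show ?thesis unfolding cl_wp_def ph p_def x_def[symmetric] e by (simp add: mult_ac)
  qed
  define c where "c = p * D * E / 2"
  have V0: "V k = c * ((D + 2 * E - 1 + x) / ((E + x) * (D + E - 1)))"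
    unfolding V 1 x_def[symmetric] c_def using nz by simp
  have V1: "V (Suc k) = c * ((1 + x) * (2 + x) * (D + 2 * E + 1 + x) / ((D + E + x) * (D + E + x + 1) * (E + x + 2) * (D + E - 1)))"
  proof -
    have e: "D + 2 * real (Suc k) = D + x + 2" "D + 2 * E - 1 + 2 * real (Suc k) = D + 2 * E + 1 + x"
      by (simp_all add: x_def)
    show ?thesis unfolding V 2 e c_def using nz(4) by (simp add: mult_ac)
  qed
  have T0: "cl_term D E k = c * ((D + E + 2 * x) / ((D + x) * (E + x)))"
  proof -
    have e: "D + E + 4 * real k = D + E + 2 * x" by (simp add: x_def)
    show ?thesis unfolding cl_term_def 1 e c_def by simp
  qed
  have T1: "cl_ratio D E * cl_term D (E + 2) k
    = c * (E * (E + 1) * (D + E + 2 + 2 * x) / ((D + E + x) * (D + E + x + 1) * (D + x) * (E + x + 2)))"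
  proof -
    have e: "D + (E + 2) + 4 * real k = D + E + 2 + 2 * x" by (simp add: x_def)
    show ?thesis unfolding cl_term_def 3 cl_ratio_def e c_def using nz(8,9,10)
      by (simp add: power2_eq_square mult_ac)
  qed
  \<comment> \<open>This and the next identity have the common value (E - x - 1)/((D + x)(D + E -
    1)); in each the numerator of the difference contains a factor that cancels,
    \<open>E + x\<close> here and \<open>Z\<close> there.\<close>
  have "(D + E + 2 * x) / ((D + x) * (E + x)) - (D + 2 * E - 1 + x) / ((E + x) * (D + E - 1))
      = (E - x - 1) / ((D + x) * (D + E - 1))"
  proof -
    have "(D + E + 2 * x) * (D + E - 1) - (D + 2 * E - 1 + x) * (D + x) = (E - x - 1) * (E + x)" by algebra
    moreover have "(D + E + 2 * x) / ((D + x) * (E + x)) - (D + 2 * E - 1 + x) / ((E + x) * (D + E - 1))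
      = ((D + E + 2 * x) * (D + E - 1) - (D + 2 * E - 1 + x) * (D + x)) / ((E + x) * ((D + x) * (D + E - 1)))"
      using nz(1,7) by (simp add: diff_divide_distrib mult_ac)
    ultimately show ?thesis using nz(2) by (simp only: mult.commute[of _ "E + x"] mult_divide_mult_cancel_left not_False_eq_True)
  qed
  moreover have "E * (E + 1) * (D + E + 2 + 2 * x) / ((D + E + x) * (D + E + x + 1) * (D + x) * (E + x + 2))
      - (1 + x) * (2 + x) * (D + 2 * E + 1 + x) / ((D + E + x) * (D + E + x + 1) * (E + x + 2) * (D + E - 1))
      = (E - x - 1) / ((D + x) * (D + E - 1))"
  proof -
    define Z where "Z = (D + E + x) * (D + E + x + 1) * (E + x + 2)"
    have Z: "Z \<noteq> 0" using nz by (simp add: Z_def)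
    have "E * (E + 1) * (D + E + 2 + 2 * x) * (D + E - 1) - (1 + x) * (2 + x) * (D + 2 * E + 1 + x) * (D + x) = Z * (E - x - 1)"
      unfolding Z_def by algebra
    moreover have "E * (E + 1) * (D + E + 2 + 2 * x) / (Z * (D + x))
      - (1 + x) * (2 + x) * (D + 2 * E + 1 + x) / (Z * (D + E - 1))
      = (E * (E + 1) * (D + E + 2 + 2 * x) * (D + E - 1) - (1 + x) * (2 + x) * (D + 2 * E + 1 + x) * (D + x)) / (Z * ((D + x) * (D + E - 1)))"
      using nz(1,7) by (simp add: diff_divide_distrib mult_ac)
    moreover have "(D + E + x) * (D + E + x + 1) * (D + x) * (E + x + 2) = Z * (D + x)"
      "(D + E + x) * (D + E + x + 1) * (E + x + 2) * (D + E - 1) = Z * (D + E - 1)"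
      by (simp_all only: Z_def mult_ac)
    ultimately show ?thesis using Z by (simp only: mult_divide_mult_cancel_left not_False_eq_True)
  qed
  ultimately have "cl_term D E k - V k = cl_ratio D E * cl_term D (E + 2) k - V (Suc k)"
    unfolding T0 T1 V0 V1 right_diff_distrib[symmetric] by (simp only:)
  then show ?thesis by simp
qed

section \<open>Bounds, recursion and starting value of the classical series\<close>

text \<open>Group the Basel series in consecutive pairs and remove the even denominators, which
  contribute a quarter of the total.\<close>

lemma inverse_odd_squares: "(\<lambda>k. 1 / (1 + 2 * real k)\<^sup>2) sums (pi\<^sup>2 / 8)"
proof -
  have b: "(\<lambda>k. 1 / (real k + 1)\<^sup>2) sums (pi\<^sup>2 / 6)" using inverse_squares_sums by (simp add: add_ac)
  have "(\<lambda>k. \<Sum>i\<in>{k * 2..<k * 2 + 2}. 1 / (real i + 1)\<^sup>2) sums (pi\<^sup>2 / 6)"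
    using sums_group[OF b, of 2] by simp
  moreover have "(\<Sum>i\<in>{k * 2..<k * 2 + 2}. 1 / (real i + 1)\<^sup>2) = 1 / (1 + 2 * real k)\<^sup>2 + (1 / 4) * (1 / (real k + 1)\<^sup>2)" for k
  proof -
    have "{k * 2..<k * 2 + 2} = {2 * k, 2 * k + 1}" by auto
    moreover have "(2 * real k + 2)\<^sup>2 = 4 * (real k + 1)\<^sup>2" by (simp add: power2_eq_square algebra_simps)
    ultimately show ?thesis by (simp add: add_ac)
  qed
  ultimately have "(\<lambda>k. 1 / (1 + 2 * real k)\<^sup>2 + (1 / 4) * (1 / (real k + 1)\<^sup>2)) sums (pi\<^sup>2 / 6)" by simp
  from sums_diff[OF this sums_mult[OF b, of "1/4"]] show ?thesis by simp
qed

text \<open>As D + E \<ge> 2, the quotient of Pochhammer symbols is at most the one with 2 in place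
  of D + E, which is 1/(1 + 2k). The argument is now 1, so this polynomial decay replaces the
  geometric one.\<close>

lemma cl_bounds:
  assumes DE: "1 \<le> D" "1 \<le> E"
  shows "0 \<le> cl_wp D E k" "cl_wp D E k \<le> D * E / ((1 + 2 * real k) * ((D + 2 * real k) * (E + 2 * real k)))"
    "0 \<le> cl_term D E k" "cl_term D E k \<le> D * E * (1 / (1 + 2 * real k)\<^sup>2)"
proof -
  define x where "x = 2 * real k"
  have x: "x \<ge> 0" by (simp add: x_def)
  have pos: "0 < pochhammer (D + E) (2 * k)" using assms by (intro pochhammer_pos) simp
  have "pochhammer 2 (2 * k) \<le> pochhammer (D + E) (2 * k)"
    unfolding pochhammer_prod using DE by (intro prod_mono) auto
  moreover have "pochhammer 2 (2 * k) = (1 + x) * pochhammer (1::real) (2 * k)"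
    using pochhammer_rec'[of "1::real" "2 * k"] pochhammer_rec[of "1::real" "2 * k"] by (simp add: x_def add_ac)
  moreover have "0 < pochhammer (1::real) (2 * k)" by (intro pochhammer_pos) simp
  ultimately have p: "0 \<le> pochhammer 1 (2 * k) / pochhammer (D + E) (2 * k)"
    "pochhammer 1 (2 * k) / pochhammer (D + E) (2 * k) \<le> 1 / (1 + x)"
    using x pos by (simp_all add: field_simps)
  have eq: "cl_wp D E k = pochhammer 1 (2 * k) / pochhammer (D + E) (2 * k) * (D * E / ((D + x) * (E + x)))"
    by (simp add: cl_wp_def x_def)
  have c: "0 \<le> D * E / ((D + x) * (E + x))" using DE x by simp
  show 0: "0 \<le> cl_wp D E k" unfolding eq using p c by (intro mult_nonneg_nonneg)
  show 1: "cl_wp D E k \<le> D * E / ((1 + 2 * real k) * ((D + 2 * real k) * (E + 2 * real k)))"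
    using mult_right_mono[OF p(2) c] unfolding eq x_def[symmetric] by simp
  have nn: "0 \<le> (D + E + 4 * real k) / 2" using DE by simp
  show "0 \<le> cl_term D E k" unfolding cl_term_def using nn 0 by (intro mult_nonneg_nonneg)
  have "(D + E + 4 * real k) / 2 * cl_wp D E k
      \<le> (D + E + 2 * x) / 2 * (D * E / ((1 + x) * ((D + x) * (E + x))))"
    using mult_left_mono[OF 1 nn] by (simp add: x_def)
  \<comment> \<open>Partial fractions: (D + E + 2x)/((D + x)(E + x)) = 1/(D + x) + 1/(E + x), and
    each summand is at most 1/(1 + x).\<close>
  also have "\<dots> = D * E / (1 + x) * ((1 / (D + x) + 1 / (E + x)) / 2)"
  proof -
    have "D + x > 0" "E + x > 0" "1 + x > 0" using DE x by simp_all
    then show ?thesis by (simp add: field_simps)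
  qed
  also have "\<dots> \<le> D * E / (1 + x) * ((1 / (1 + x) + 1 / (1 + x)) / 2)"
    using DE x by (intro mult_left_mono divide_right_mono add_mono divide_left_mono) auto
  also have "(1 / (1 + x) + 1 / (1 + x)) / 2 = 1 / (1 + x)" using x by (simp add: field_simps)
  finally show "cl_term D E k \<le> D * E * (1 / (1 + 2 * real k)\<^sup>2)"
    unfolding cl_term_def by (simp add: x_def power2_eq_square)
qed

lemma cl_omega_bounds:
  assumes DE: "1 \<le> D" "1 \<le> E"
  shows "summable (cl_term D E)" "0 \<le> cl_omega D E" "cl_omega D E \<le> D * E * (pi\<^sup>2 / 8)"
proof -
  have m: "(\<lambda>k. D * E * (1 / (1 + 2 * real k)\<^sup>2)) sums (D * E * (pi\<^sup>2 / 8))"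
    by (intro sums_mult inverse_odd_squares)
  show sm: "summable (cl_term D E)"
    using cl_bounds(3,4)[OF DE] by (intro summable_comparison_test'[OF sums_summable[OF m], of 0]) auto
  show "0 \<le> cl_omega D E" unfolding cl_omega_def using cl_bounds(3)[OF DE] by (intro suminf_nonneg sm)
  show "cl_omega D E \<le> D * E * (pi\<^sup>2 / 8)"
    unfolding cl_omega_def sums_unique[OF m] using cl_bounds(4)[OF DE]
    by (intro suminf_le sm sums_summable[OF m])
qed

text \<open>Again the sum of the telescoping relation. That \<open>V\<close> vanishes at infinity
  rests on the bound for \<open>cl_wp\<close>: one factor 1/(1 + 2k) is left after the linear
  factors are compared.\<close>

lemma cl_omega_step:
  assumes DE: "1 \<le> D" "1 \<le> E"
  shows "cl_omega D E = cl_bdry D E + cl_ratio D E * cl_omega D (E + 2)"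
proof -
  define V where "V k = cl_wp D E k * (D + 2 * real k) * (D + 2 * E - 1 + 2 * real k) / (2 * (D + E - 1))" for k
  have V0: "V \<longlonglongrightarrow> 0"
  proof (rule Lim_null_comparison)
    have "norm (V k) \<le> D * E * (D + 2 * E) / (2 * (D + E - 1)) * (1 / (1 + 2 * real k))" for k
    proof -
      define x where "x = 2 * real k"
      have x: "x \<ge> 0" by (simp add: x_def)
      have "0 \<le> V k" unfolding V_def using cl_bounds(1)[OF DE, of k] DE by simp
      have le: "(D + 2 * E - 1 + x) / (E + x) \<le> D + 2 * E"
      proof -
        have "D + 2 * E - 1 + x \<le> (D + 2 * E) * (1 + x)"
        proof -
          have "0 \<le> E * x" using DE x by simp
          then show ?thesis using mult_right_mono[OF DE(1) x] by (simp add: algebra_simps)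
        qed
        also have "\<dots> \<le> (D + 2 * E) * (E + x)" using DE x by (intro mult_left_mono) auto
        finally show ?thesis using DE x by (simp add: divide_le_eq)
      qed
      have "V k \<le> D * E / ((1 + x) * ((D + x) * (E + x))) * (D + x) * (D + 2 * E - 1 + x) / (2 * (D + E - 1))"
        unfolding V_def x_def using cl_bounds(2)[OF DE, of k] DE by (intro divide_right_mono mult_right_mono) auto
      also have "\<dots> = D * E / (2 * (D + E - 1)) * (1 / (1 + x)) * ((D + 2 * E - 1 + x) / (E + x))"
        using DE x by (simp add: divide_simps)
      also have "\<dots> \<le> D * E / (2 * (D + E - 1)) * (1 / (1 + x)) * (D + 2 * E)"
        using DE x by (intro mult_left_mono le) auto
      finally have "V k \<le> D * E / (2 * (D + E - 1)) * (1 / (1 + x)) * (D + 2 * E)" .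
      then show ?thesis using \<open>0 \<le> V k\<close> by (simp add: x_def mult_ac)
    qed
    then show "\<forall>\<^sub>F k in sequentially. norm (V k) \<le> D * E * (D + 2 * E) / (2 * (D + E - 1)) * (1 / (1 + 2 * real k))"
      by simp
    have "(\<lambda>k. 1 / (1 + 2 * real k)) \<longlonglongrightarrow> 0" by (rule tendsto_inverse_linear) simp
    then show "(\<lambda>k. D * E * (D + 2 * E) / (2 * (D + E - 1)) * (1 / (1 + 2 * real k))) \<longlonglongrightarrow> 0"
      by (rule tendsto_mult_right_zero)
  qed
  have "(\<lambda>k. V k - V (Suc k)) sums (V 0 - 0)" by (intro telescope_sums' V0)
  moreover have "cl_term D (E + 2) sums cl_omega D (E + 2)"
    unfolding cl_omega_def using DE by (intro summable_sums cl_omega_bounds(1)) auto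
  ultimately have "cl_term D E sums (cl_ratio D E * cl_omega D (E + 2) + (V 0 - 0))"
    unfolding cl_telescope[OF DE V_def] by (intro sums_add sums_mult)
  moreover have "V 0 = cl_bdry D E" using DE by (simp add: V_def cl_bdry_def cl_wp_def)
  ultimately show ?thesis unfolding cl_omega_def using sums_unique by fastforce
qed

lemma cl_omega_commute: "cl_omega D E = cl_omega E D"
  unfolding cl_omega_def cl_term_def cl_wp_def by (simp add: mult_ac add_ac)

lemma cl_omega_start: "cl_omega 1 1 = pi\<^sup>2 / 8"
proof -
  \<comment> \<open>The quotient (1)_(2k)/(2)_(2k) = 1/(1 + 2k) cancels the factor a + 2k = 1 + 2k,
    leaving the inverse odd squares.\<close>
  have "cl_term 1 1 k = 1 / (1 + 2 * real k)\<^sup>2" for k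
  proof -
    have "pochhammer 2 (2 * k) = (1 + 2 * real k) * pochhammer (1::real) (2 * k)"
      using pochhammer_rec'[of "1::real" "2 * k"] pochhammer_rec[of "1::real" "2 * k"] by (simp add: add_ac)
    moreover have "0 < pochhammer (1::real) (2 * k)" by (intro pochhammer_pos) simp
    moreover have e: "(1 + 1 + 4 * real k) / 2 = 1 + 2 * real k" by simp
    ultimately show ?thesis unfolding cl_term_def e by (simp add: cl_wp_def power2_eq_square)
  qed
  then have "cl_term 1 1 = (\<lambda>k. 1 / (1 + 2 * real k)\<^sup>2)" by (rule ext)
  then show ?thesis unfolding cl_omega_def using sums_unique[OF inverse_odd_squares] by simp
qed

section \<open>The classical three-step recursion and its telescoping sum\<close>

text \<open>The limit of \<open>lam s n\<close> as s tends to 1, with Pochhammer symbols paired by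
  the duplication formula so that the factorials of (ii) appear.\<close>

definition cl_lam :: "nat \<Rightarrow> real" where
  "cl_lam n = fact (2 * n) * fact (4 * n + 1) / (fact (6 * n + 1) * (2 * real n + 1) * (4 * real n + 1)\<^sup>2)"

definition cl_triple_bdry :: "real \<Rightarrow> real" where
  "cl_triple_bdry x = cl_bdry (2 * x + 1) (4 * x + 1)
    + cl_ratio (2 * x + 1) (4 * x + 1) * (cl_bdry (4 * x + 3) (2 * x + 1)
    + cl_ratio (4 * x + 3) (2 * x + 1) * cl_bdry (2 * x + 3) (4 * x + 3))"

definition cl_triple_ratio :: "real \<Rightarrow> real" where
  "cl_triple_ratio x = cl_ratio (2 * x + 1) (4 * x + 1) * cl_ratio (4 * x + 3) (2 * x + 1)
    * cl_ratio (2 * x + 3) (4 * x + 3)"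

text \<open>The same path of exponents as in \<open>omega_recursion\<close>, with a real variable in
  place of n.\<close>

lemma cl_omega_recursion:
  assumes "0 \<le> x"
  shows "cl_omega (2 * x + 1) (4 * x + 1)
    = cl_triple_bdry x + cl_triple_ratio x * cl_omega (2 * (x + 1) + 1) (4 * (x + 1) + 1)"
proof -
  have e: "2 * (x + 1) + 1 = 2 * x + 3" "4 * (x + 1) + 1 = 4 * x + 5"
    "4 * x + 1 + 2 = 4 * x + 3" "2 * x + 1 + 2 = 2 * x + 3" "4 * x + 3 + 2 = 4 * x + 5" by simp_all
  show ?thesis
    using cl_omega_step[of "2 * x + 1" "4 * x + 1"] cl_omega_step[of "4 * x + 3" "2 * x + 1"]
      cl_omega_step[of "2 * x + 3" "4 * x + 3"] cl_omega_commute[of "2 * x + 1" "4 * x + 3"]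
      cl_omega_commute[of "4 * x + 3" "2 * x + 3"] assms
    unfolding e cl_triple_bdry_def cl_triple_ratio_def by (simp add: distrib_left)
qed

lemma cl_lam_Suc: "cl_lam (Suc n) = cl_lam n * cl_triple_ratio (real n)"
proof -
  have m: "2 * Suc n = Suc (Suc (2 * n))" "4 * Suc n + 1 = Suc (Suc (Suc (Suc (4 * n + 1))))"
    "6 * Suc n + 1 = Suc (Suc (Suc (Suc (Suc (Suc (6 * n + 1))))))" by simp_all
  define x where "x = real n"
  have x: "x \<ge> 0" by (simp add: x_def)
  define A B C where "A = (fact (2 * n) :: real)" and "B = (fact (4 * n + 1) :: real)"
    and "C = (fact (6 * n + 1) :: real)"
  note ABC = A_def B_def C_def
  define F where "F = A * B / C"
  have f: "fact (2 * Suc n) = (2 * x + 2) * ((2 * x + 1) * A)"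
    "fact (4 * Suc n + 1) = (4 * x + 5) * ((4 * x + 4) * ((4 * x + 3) * ((4 * x + 2) * B)))"
    "fact (6 * Suc n + 1) = (6 * x + 7) * ((6 * x + 6) * ((6 * x + 5) * ((6 * x + 4) * ((6 * x + 3) * ((6 * x + 2) * C)))))"
    unfolding m fact_Suc ABC[symmetric] by (simp_all add: x_def add_ac)
  have "cl_lam (Suc n) = F * ((2 * x + 1) * (2 * x + 2) * ((4 * x + 2) * (4 * x + 3) * (4 * x + 4) * (4 * x + 5)))
    / ((6 * x + 2) * (6 * x + 3) * (6 * x + 4) * (6 * x + 5) * (6 * x + 6) * (6 * x + 7) * (2 * x + 3) * (4 * x + 5)\<^sup>2)"
    unfolding cl_lam_def f F_def by (simp add: x_def add_ac mult_ac)
  moreover have "cl_lam n = F / ((2 * x + 1) * (4 * x + 1)\<^sup>2)" unfolding cl_lam_def F_def ABC x_def by (simp only: divide_divide_eq_left mult.assoc)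
  moreover have "cl_triple_ratio x = (4 * x + 1)\<^sup>2 * (4 * x + 2) / ((6 * x + 2) * (6 * x + 3) * (4 * x + 3))
      * ((2 * x + 1)\<^sup>2 * (2 * x + 2) / ((6 * x + 4) * (6 * x + 5) * (2 * x + 3)))
      * ((4 * x + 3)\<^sup>2 * (4 * x + 4) / ((6 * x + 6) * (6 * x + 7) * (4 * x + 5)))"
    unfolding cl_triple_ratio_def cl_ratio_def by (simp add: add_ac)
  moreover have "2 * x + 1 \<noteq> 0" "4 * x + 1 \<noteq> 0" "4 * x + 3 \<noteq> 0" "4 * x + 5 \<noteq> 0" using x by linarith+
  ultimately show ?thesis unfolding x_def[symmetric] by (simp add: power2_eq_square mult_ac)
qed

text \<open>The quotient of factorials is the reciprocal of a binomial coefficient, hence at most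
  1.\<close>

lemma cl_lam_bounds: "0 \<le> cl_lam n" "cl_lam n \<le> 1 / ((2 * real n + 1) * (4 * real n + 1)\<^sup>2)"
proof -
  have "fact (2 * n) * fact (6 * n + 1 - 2 * n) * (6 * n + 1 choose (2 * n)) = fact (6 * n + 1)"
    by (rule binomial_fact_lemma) simp
  moreover have "6 * n + 1 - 2 * n = 4 * n + 1" "1 \<le> (6 * n + 1 choose (2 * n))" by (simp_all add: Suc_le_eq)
  ultimately have "fact (2 * n) * fact (4 * n + 1) \<le> (fact (6 * n + 1) :: nat)"
    by (metis mult.right_neutral mult_le_mono2)
  then have "real (fact (2 * n) * fact (4 * n + 1)) \<le> real (fact (6 * n + 1))" by (simp only: of_nat_le_iff)
  then have "fact (2 * n) * fact (4 * n + 1) / fact (6 * n + 1) \<le> (1 :: real)" by (simp del: fact_Suc)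
  from divide_right_mono[OF this, of "(2 * real n + 1) * (4 * real n + 1)\<^sup>2"]
  show "cl_lam n \<le> 1 / ((2 * real n + 1) * (4 * real n + 1)\<^sup>2)" by (simp add: cl_lam_def mult.assoc del: fact_Suc)
  show "0 \<le> cl_lam n" by (simp add: cl_lam_def)
qed

lemma cl_accelerated_sums: "(\<lambda>n. cl_lam n * cl_triple_bdry (real n)) sums (pi\<^sup>2 / 8)"
proof -
  define f where "f n = cl_omega (2 * real n + 1) (4 * real n + 1)" for n
  have "cl_lam n * cl_triple_bdry (real n) = cl_lam n * f n - cl_lam (Suc n) * f (Suc n)" for n
    using cl_omega_recursion[of "real n"] unfolding cl_lam_Suc f_def by (simp add: algebra_simps)
  moreover have "(\<lambda>n. cl_lam n * f n) \<longlonglongrightarrow> 0"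
  proof (rule Lim_null_comparison)
    \<comment> \<open>The bound for \<open>cl_omega\<close> grows like D E = (2n+1)(4n+1); the
      rational factor of \<open>cl_lam\<close> has one more power of 4n + 1, which gives the
      decay.\<close>
    have "norm (cl_lam n * f n) \<le> pi\<^sup>2 / 8 * (1 / (1 + 4 * real n))" for n
    proof -
      have f: "0 \<le> f n" "f n \<le> (2 * real n + 1) * (4 * real n + 1) * (pi\<^sup>2 / 8)"
        unfolding f_def by (intro cl_omega_bounds; simp)+
      have "cl_lam n * f n \<le> 1 / ((2 * real n + 1) * (4 * real n + 1)\<^sup>2) * ((2 * real n + 1) * (4 * real n + 1) * (pi\<^sup>2 / 8))"
        using f cl_lam_bounds[of n] by (intro mult_mono) auto
      also have "\<dots> = pi\<^sup>2 / 8 * (1 / (1 + 4 * real n))"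
        by (simp add: power2_eq_square divide_simps)
      finally show ?thesis using f cl_lam_bounds[of n] by simp
    qed
    then show "\<forall>\<^sub>F n in sequentially. norm (cl_lam n * f n) \<le> pi\<^sup>2 / 8 * (1 / (1 + 4 * real n))" by simp
    have "(\<lambda>n. 1 / (1 + 4 * real n)) \<longlonglongrightarrow> 0" by (rule tendsto_inverse_linear) simp
    then show "(\<lambda>n. pi\<^sup>2 / 8 * (1 / (1 + 4 * real n))) \<longlonglongrightarrow> 0" by (rule tendsto_mult_right_zero)
  qed
  then have "(\<lambda>n. cl_lam n * f n - cl_lam (Suc n) * f (Suc n)) sums (cl_lam 0 * f 0 - 0)"
    by (rule telescope_sums')
  ultimately show ?thesis by (simp add: f_def cl_lam_def cl_omega_start)
qed

section \<open>Translation into the summands and the value of part (ii)\<close>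

lemma classical_series:
  "(\<lambda>n::nat.
      (fact (2 * n) * fact (4 * n + 1))
      / (fact (6 * n + 1) * (1 + 2 * real n) * (1 + 3 * real n))
      * (1
         + 9 * (1 + 2 * real n) * (1 + 3 * real n) * (1 + 5 * real n)
           / (2 * (1 + 4 * real n) ^ 2 * (1 + 6 * real n))
         + 3 * (1 + real n) * (1 + 2 * real n) ^ 2 * (4 + 5 * real n)
           / (2 * (2 + 3 * real n) * (3 + 4 * real n) * (5 + 6 * real n) ^ 2)))
    sums (9 * pi ^ 2 / 16)" (is "?t sums _")
proof -
  \<comment> \<open>The middle boundary term, times its ratio and the rational part of
    \<open>cl_lam\<close>, is 2/9 of 1/((1 + 2n)(1 + 3n)). The constant 9/2 therefore turns it into
    the leading 1 in the braces and pi^2/8 into 9 pi^2/16.\<close>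
  have "?t n = 9 / 2 * (cl_lam n * cl_triple_bdry (real n))" for n
  proof -
    define x where "x = real n"
    have x: "x \<ge> 0" by (simp add: x_def)
    define F where "F = fact (2 * n) * fact (4 * n + 1) / (fact (6 * n + 1) :: real)"
    have nz: "1 + 2 * x \<noteq> 0" "1 + 3 * x \<noteq> 0" "1 + 4 * x \<noteq> 0" "1 + 6 * x \<noteq> 0" "2 + 3 * x \<noteq> 0"
      "3 + 4 * x \<noteq> 0" "5 + 6 * x \<noteq> 0" "3 + 2 * x \<noteq> 0"
      using x by linarith+
    have r1: "cl_ratio (2 * x + 1) (4 * x + 1) = (1 + 4 * x)\<^sup>2 * (2 * (1 + 2 * x)) / (2 * (1 + 3 * x) * (3 * (1 + 2 * x)) * (3 + 4 * x))"
      unfolding cl_ratio_def by (simp add: algebra_simps)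
    have r2: "cl_ratio (4 * x + 3) (2 * x + 1) = (1 + 2 * x)\<^sup>2 * (2 * (1 + x)) / (2 * (2 + 3 * x) * (5 + 6 * x) * (3 + 2 * x))"
      unfolding cl_ratio_def by (simp add: algebra_simps)
    have b1: "cl_bdry (2 * x + 1) (4 * x + 1) = (1 + 2 * x) * (2 * (1 + 5 * x)) / (2 * (1 + 6 * x))"
      unfolding cl_bdry_def by (simp add: algebra_simps)
    have b2: "cl_bdry (4 * x + 3) (2 * x + 1) = (3 + 4 * x) * (4 * (1 + 2 * x)) / (2 * (3 * (1 + 2 * x)))"
      unfolding cl_bdry_def by (simp add: algebra_simps)
    have b3: "cl_bdry (2 * x + 3) (4 * x + 3) = (3 + 2 * x) * (2 * (4 + 5 * x)) / (2 * (5 + 6 * x))"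
      unfolding cl_bdry_def by (simp add: algebra_simps)
    have "?t n = F / ((1 + 2 * x) * (1 + 3 * x)) * (1 + 9 * (1 + 2 * x) * (1 + 3 * x) * (1 + 5 * x)
           / (2 * (1 + 4 * x) ^ 2 * (1 + 6 * x))
         + 3 * (1 + x) * (1 + 2 * x) ^ 2 * (4 + 5 * x)
           / (2 * (2 + 3 * x) * (3 + 4 * x) * (5 + 6 * x) ^ 2))"
      unfolding F_def x_def by simp
    also have "\<dots> = 9 / 2 * (F / ((1 + 2 * x) * (1 + 4 * x)\<^sup>2) * cl_triple_bdry x)"
      unfolding cl_triple_bdry_def r1 r2 b1 b2 b3
      using nz by (simp add: divide_simps) (simp add: algebra_simps power2_eq_square)
    finally show ?thesis by (simp add: cl_lam_def F_def x_def add_ac)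
  qed
  moreover have "(\<lambda>n. 9 / 2 * (cl_lam n * cl_triple_bdry (real n))) sums (9 / 2 * (pi\<^sup>2 / 8))"
    by (intro sums_mult cl_accelerated_sums)
  moreover have "9 / 2 * (pi\<^sup>2 / 8) = 9 * pi ^ 2 / 16" by simp
  ultimately show ?thesis by (simp only:)
qed

theorem mainTheorem15:
  shows "(\<forall>q::real. 0 < q \<and> q < 1 \<longrightarrow>
    (\<lambda>n::nat.
      q powr (2 * real n ^ 2 + 3 * real n / 2)
      * (qpochs [q, q powr (1/2), q powr (1/2)] q n
          * qpochs [q, q powr (3/2), q powr (3/2)] q (2 * n)
          * (1 - q ^ (2 * n + 1)) * (1 - q ^ (4 * n + 2)))
      / (qpoch (q powr (3/2)) q n * qpoch (q powr (3/2)) q (2 * n)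
          * qpochs [q, q powr (3/2)] q (3 * n)
          * (1 - q ^ (3 * n + 1)) * (1 - q powr (3 * real n + 3/2)) ^ 2)
      * (q powr (real n + 1/2)
         + ((1 - q powr (real n + 1/2)) * (1 - q ^ (3 * n + 1))
              * (1 - q powr (3 * real n + 3/2)) ^ 2 * (1 - q ^ (5 * n + 1)))
           / ((1 - q ^ (2 * n + 1)) * (1 - q powr (2 * real n + 1/2)) ^ 2
              * (1 - q powr (3 * real n + 1/2)) * (1 - q ^ (4 * n + 2)))
         + q ^ (3 * n + 2)
           * ((1 - q powr (real n + 1/2)) ^ 2 * (1 - q ^ (n + 1))
              * (1 - q powr (3 * real n + 3/2)) * (1 - q ^ (5 * n + 4)))
           / ((1 - q ^ (3 * n + 2)) * (1 - q powr (2 * real n + 3/2))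
              * (1 - q powr (3 * real n + 5/2)) ^ 2 * (1 - q ^ (4 * n + 2)))))
    sums (qpoch_inf q q ^ 4
          / (qpoch_inf (q powr (1/2)) q ^ 3 * qpoch_inf (q powr (3/2)) q)))
  \<and>
    (\<lambda>n::nat.
      (fact (2 * n) * fact (4 * n + 1))
      / (fact (6 * n + 1) * (1 + 2 * real n) * (1 + 3 * real n))
      * (1
         + 9 * (1 + 2 * real n) * (1 + 3 * real n) * (1 + 5 * real n)
           / (2 * (1 + 4 * real n) ^ 2 * (1 + 6 * real n))
         + 3 * (1 + real n) * (1 + 2 * real n) ^ 2 * (4 + 5 * real n)
           / (2 * (2 + 3 * real n) * (3 + 4 * real n) * (5 + 6 * real n) ^ 2)))
    sums (9 * pi ^ 2 / 16)"
  using q_series classical_series by blast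

end
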